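(* Let $q\in\mathbb{C}^*$ be generic. Every simple object of the category $\mathcal{C}$ of admissible $\mathcal{A}_q(2)$-modules can be obtained (up to isomorphism) as the restriction to $\mathcal{A}_q(2)$ of the basic $\mathcal{L}_q(2)$-module twisted by an appropriate automorphism of $\mathcal{L}_q(2)$.
   Context: Generic means that $q$ is not a root of unity; $\mathbb{Z}_+$ denotes the non-negative integers. $\mathcal{L}_q(2)$ is the associative unital $\mathbb{C}$-algebra generated by $x^{\pm1},y^{\pm1}$ with relation $xy=q\,yx$, and $\mathcal{A}_q(2)$ is its subalgebra generated by $x,y$ (which is the algebra with generators $x,y$ and the single relation $xy=q\,yx$). Modules are left modules. The basic $\mathcal{L}_q(2)$-module is $V=\mathbb{C}[t,t^{-1}]$ with $xf(t)=f(qt)$, $yf(t)=tf(t)$. Its twist by an automorphism $\tau$ of $\mathcal{L}_q(2)$ is the vector space $V$ with action $u\star f=\tau(u)f$. For $(m,n)\in\mathbb{Z}_+^2\setminus\{(0,0)\}$ and $D=x^my^n$, an $\mathcal{A}_q(2)$-module $M$ is locally $D$-finite if $\mathbb{C}[D]w$ is finite dimensional for every $w\in M$; $\widetilde{\mathcal{C}}_{(m,n)}$ is the category of locally $D$-finite $\mathcal{A}_q(2)$-modules. Let $\widetilde{\mathcal{A}}^{(1,1)}_q$ be the localisation of $\mathcal{A}_q(2)$ at the powers of $xy$, and for a module $M$ let $\kappa^{(1,1)}:M\to\widetilde{\mathcal{A}}^{(1,1)}_q\otimes_{\mathcal{A}_q(2)}M$, $v\mapsto1\otimes v$. $M$ is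 admissible if there are finitely many submodules $M_j$ with $M=\sum_jM_j$ such that (i) each $M_j\in\widetilde{\mathcal{C}}_{(m_j,n_j)}$ for some $(m_j,n_j)\in\mathbb{Z}_+^2\setminus\{(0,0)\}$, and (ii) $\kappa^{(1,1)}$ is injective. $\mathcal{C}$ is the category of admissible modules; its simple objects are the objects that are simple as $\mathcal{A}_q(2)$-modules. *)

theory Defs
  imports "HOL-Algebra.Algebra" "HOL-Library.Poly_Mapping"
begin

section \<open>Complex algebras, left modules\<close>

text \<open>
  A complex algebra is represented by the record type \<open>module\<close> of HOL-Algebra with scalars in
  \<open>complex\<close>; it need not be commutative, so the locale \<open>algebra\<close> of HOL-Algebra does not apply.
\<close>

locale complex_algebra = ring A for A :: "(complex, 'a) module" (structure) +
  assumes smult_closed [simp, intro]: "a \<in> carrier A \<Longrightarrow> c \<odot> a \<in> carrier A"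
    and smult_l_distr: "a \<in> carrier A \<Longrightarrow> (c + d) \<odot> a = c \<odot> a \<oplus> d \<odot> a"
    and smult_r_distr: "a \<in> carrier A \<Longrightarrow> b \<in> carrier A \<Longrightarrow> c \<odot> (a \<oplus> b) = c \<odot> a \<oplus> c \<odot> b"
    and smult_assoc: "a \<in> carrier A \<Longrightarrow> (c * d) \<odot> a = c \<odot> (d \<odot> a)"
    and smult_one [simp]: "a \<in> carrier A \<Longrightarrow> 1 \<odot> a = a"
    and smult_mult_left: "a \<in> carrier A \<Longrightarrow> b \<in> carrier A \<Longrightarrow> (c \<odot> a) \<otimes> b = c \<odot> (a \<otimes> b)"
    and smult_mult_right: "a \<in> carrier A \<Longrightarrow> b \<in> carrier A \<Longrightarrow> a \<otimes> (c \<odot> b) = c \<odot> (a \<otimes> b)"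

definition algebra_automorphisms :: "(complex, 'a) module \<Rightarrow> ('a \<Rightarrow> 'a) set" where
  "algebra_automorphisms A =
     {\<tau> \<in> ring_iso A A. \<forall>c. \<forall>a \<in> carrier A. \<tau> (c \<odot>\<^bsub>A\<^esub> a) = c \<odot>\<^bsub>A\<^esub> \<tau> a}"

definition generated_subalgebra :: "(complex, 'a) module \<Rightarrow> 'a set \<Rightarrow> 'a set" where
  "generated_subalgebra A S =
     \<Inter>{B. subring B A \<and> (\<forall>c. \<forall>b \<in> B. c \<odot>\<^bsub>A\<^esub> b \<in> B) \<and> S \<subseteq> B}"

text \<open>
  The locale \<open>module\<close> of HOL-Algebra insists on a commutative ring; the axioms below are the same
  without commutativity. The locale \<open>submodule\<close> of HOL-Algebra has no such restriction.
  As usual, the ring structure carried by the record \<open>M\<close> besides its addition is irrelevant.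
\<close>

locale left_module = R?: ring R + M?: abelian_group M
  for R :: "('a, 'r) ring_scheme" (structure) and M :: "('a, 'v) module" (structure) +
  assumes act_closed [simp, intro]:
      "a \<in> carrier R \<Longrightarrow> v \<in> carrier M \<Longrightarrow> a \<odot>\<^bsub>M\<^esub> v \<in> carrier M"
    and act_l_distr: "a \<in> carrier R \<Longrightarrow> b \<in> carrier R \<Longrightarrow> v \<in> carrier M \<Longrightarrow>
      (a \<oplus> b) \<odot>\<^bsub>M\<^esub> v = a \<odot>\<^bsub>M\<^esub> v \<oplus>\<^bsub>M\<^esub> b \<odot>\<^bsub>M\<^esub> v"
    and act_r_distr: "a \<in> carrier R \<Longrightarrow> v \<in> carrier M \<Longrightarrow> w \<in> carrier M \<Longrightarrow>
      a \<odot>\<^bsub>M\<^esub> (v \<oplus>\<^bsub>M\<^esub> w) = a \<odot>\<^bsub>M\<^esub> v \<oplus>\<^bsub>M\<^esub> a \<odot>\<^bsub>M\<^esub> w"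
    and act_assoc: "a \<in> carrier R \<Longrightarrow> b \<in> carrier R \<Longrightarrow> v \<in> carrier M \<Longrightarrow>
      (a \<otimes> b) \<odot>\<^bsub>M\<^esub> v = a \<odot>\<^bsub>M\<^esub> (b \<odot>\<^bsub>M\<^esub> v)"
    and act_one [simp]: "v \<in> carrier M \<Longrightarrow> \<one> \<odot>\<^bsub>M\<^esub> v = v"

definition simple_module :: "(complex, 'a) module \<Rightarrow> ('a, 'v) module \<Rightarrow> bool" where
  "simple_module A M \<longleftrightarrow> left_module A M \<and> carrier M \<noteq> {\<zero>\<^bsub>M\<^esub>} \<and>
     (\<forall>N. submodule N A M \<longrightarrow> N = {\<zero>\<^bsub>M\<^esub>} \<or> N = carrier M)"

definition module_isomorphic ::
    "(complex, 'a) module \<Rightarrow> ('a, 'v) module \<Rightarrow> ('a, 'w) module \<Rightarrow> bool" where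
  "module_isomorphic A M N \<longleftrightarrow> (\<exists>h. bij_betw h (carrier M) (carrier N) \<and>
     (\<forall>v \<in> carrier M. \<forall>w \<in> carrier M. h (v \<oplus>\<^bsub>M\<^esub> w) = h v \<oplus>\<^bsub>N\<^esub> h w) \<and>
     (\<forall>a \<in> carrier A. \<forall>v \<in> carrier M. h (a \<odot>\<^bsub>M\<^esub> v) = a \<odot>\<^bsub>N\<^esub> h v))"

definition twist :: "('a \<Rightarrow> 'a) \<Rightarrow> ('a, 'v) module \<Rightarrow> ('a, 'v) module" where
  "twist \<tau> V = V\<lparr>smult := (\<lambda>u v. \<tau> u \<odot>\<^bsub>V\<^esub> v)\<rparr>"

text \<open>
  The linear span of a finite set \<open>B\<close>; a module over a complex algebra \<open>A\<close> is a complex vector space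
  through the scalars \<open>c \<odot> \<one>\<close> of \<open>A\<close>.
\<close>

definition complex_span :: "(complex, 'a) module \<Rightarrow> ('a, 'v) module \<Rightarrow> 'v set \<Rightarrow> 'v set" where
  "complex_span A M B = {\<Oplus>\<^bsub>M\<^esub>b\<in>B. (c b \<odot>\<^bsub>A\<^esub> \<one>\<^bsub>A\<^esub>) \<odot>\<^bsub>M\<^esub> b |c. True}"

definition locally_finite :: "(complex, 'a) module \<Rightarrow> 'a \<Rightarrow> ('a, 'v) module \<Rightarrow> bool" where
  "locally_finite A D M \<longleftrightarrow> (\<forall>w \<in> carrier M. \<exists>B. finite B \<and> B \<subseteq> carrier M \<and>
     {u \<odot>\<^bsub>M\<^esub> w |u. u \<in> generated_subalgebra A {D}} = complex_span A M B)"


section \<open>Algebras given by generators and relations\<close>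

text \<open>
  With concatenation as addition, finitely supported functions on words form the free algebra:
  their product from \<^theory>\<open>HOL-Library.Poly_Mapping\<close> is then the convolution product, and
  \<open>Poly_Mapping.single [] c\<close> is the scalar \<open>c\<close>.
\<close>

instantiation list :: (type) monoid_add
begin

definition zero_list :: "'a list" where "zero_list = []"
definition plus_list :: "'a list \<Rightarrow> 'a list \<Rightarrow> 'a list" where "plus_list = (@)"

instance by standard (simp_all add: zero_list_def plus_list_def)

end

type_synonym 'g free_elem = "'g list \<Rightarrow>\<^sub>0 complex"

definition free_algebra :: "'g set \<Rightarrow> (complex, 'g free_elem) module" where
  "free_algebra G =
     \<lparr>carrier = {f. \<forall>w \<in> Poly_Mapping.keys f. set w \<subseteq> G}, monoid.mult = (*), one = 1,
      ring.zero = 0, add = (+), smult = (\<lambda>c f. Poly_Mapping.single [] c * f)\<rparr>"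

definition free_gen :: "'g \<Rightarrow> 'g free_elem" where
  "free_gen g = Poly_Mapping.single [g] 1"

definition quotient_algebra :: "(complex, 'a) module \<Rightarrow> 'a set \<Rightarrow> (complex, 'a set) module" where
  "quotient_algebra A I = ring.extend (A Quot I)
     (module.fields (\<lambda>c U. (I +>\<^bsub>A\<^esub> (c \<odot>\<^bsub>A\<^esub> \<one>\<^bsub>A\<^esub>)) \<otimes>\<^bsub>A Quot I\<^esub> U))"

definition relation_ideal :: "'g set \<Rightarrow> 'g free_elem set \<Rightarrow> 'g free_elem set" where
  "relation_ideal G R = Idl\<^bsub>free_algebra G\<^esub> R"

definition presented_algebra ::
    "'g set \<Rightarrow> 'g free_elem set \<Rightarrow> (complex, 'g free_elem set) module" where
  "presented_algebra G R = quotient_algebra (free_algebra G) (relation_ideal G R)"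

definition presented_class :: "'g set \<Rightarrow> 'g free_elem set \<Rightarrow> 'g free_elem \<Rightarrow> 'g free_elem set" where
  "presented_class G R f = relation_ideal G R +>\<^bsub>free_algebra G\<^esub> f"


lemma free_algebra_simps [simp]:
  "carrier (free_algebra G) = {f. \<forall>w \<in> Poly_Mapping.keys f. set w \<subseteq> G}"
  "x \<otimes>\<^bsub>free_algebra G\<^esub> y = x * y" "\<one>\<^bsub>free_algebra G\<^esub> = 1" "\<zero>\<^bsub>free_algebra G\<^esub> = 0"
  "x \<oplus>\<^bsub>free_algebra G\<^esub> y = x + y" "c \<odot>\<^bsub>free_algebra G\<^esub> x = Poly_Mapping.single [] c * x"
  by (simp_all add: free_algebra_def)

lemma single_Nil_commute:
  "Poly_Mapping.single [] c * f = f * Poly_Mapping.single [] (c :: complex)"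
proof (induction f rule: Poly_Mapping.update_induct)
  case (update f a b)
  have "Poly_Mapping.update a b f = f + Poly_Mapping.single a b"
    using update.hyps
    by (intro poly_mapping_eqI)
       (auto simp: lookup_update lookup_add lookup_single when_def in_keys_iff)
  then show ?case
    using update.IH
    by (simp add: distrib_left distrib_right mult_single plus_list_def mult.commute)
qed auto

lemma one_free: "(1 :: 'g free_elem) = Poly_Mapping.single [] 1"
  by (metis single_one zero_list_def)

lemma keys_free_mult: "Poly_Mapping.keys (f * g :: 'g free_elem) \<subseteq>
    {u @ v |u v. u \<in> Poly_Mapping.keys f \<and> v \<in> Poly_Mapping.keys g}"
  using keys_mult[of f g] by (simp add: plus_list_def)

lemma free_mult_closed:
  assumes "f \<in> carrier (free_algebra G)" "g \<in> carrier (free_algebra G)"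
  shows "f * g \<in> carrier (free_algebra G)"
  using keys_free_mult[of f g] assms by fastforce

lemma complex_algebra_free_algebra: "complex_algebra (free_algebra G)"
proof -
  have one: "1 \<in> carrier (free_algebra G)"
    by (auto simp: one_free)
  have add: "f + g \<in> carrier (free_algebra G)"
    if "f \<in> carrier (free_algebra G)" "g \<in> carrier (free_algebra G)" for f g
    using that Poly_Mapping.keys_add[of f g] by fastforce
  have "ring (free_algebra G)"
  proof (rule ringI)
    show "abelian_group (free_algebra G)"
    proof (rule abelian_groupI)
      fix x assume x: "x \<in> carrier (free_algebra G)"
      then have "- x \<in> carrier (free_algebra G)" by (simp add: keys_minus)
      then show "\<exists>y \<in> carrier (free_algebra G). y \<oplus>\<^bsub>free_algebra G\<^esub> x = \<zero>\<^bsub>free_algebra G\<^esub>"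
        by (intro bexI[of _ "- x"]) simp_all
    qed (use add in \<open>auto simp: add_ac simp del: free_algebra_simps(1)\<close>, simp)
    show "Group.monoid (free_algebra G)"
      using one free_mult_closed[of _ G]
      by unfold_locales (auto simp: mult.assoc simp del: free_algebra_simps(1))
  qed (auto simp: distrib_left distrib_right)
  then interpret ring "free_algebra G" .
  show ?thesis
  proof (unfold_locales, goal_cases)
    case (1 a c)
    have "Poly_Mapping.single [] c \<in> carrier (free_algebra G)" by auto
    from free_mult_closed[OF this 1] show ?case by (simp del: keys_single)
  next
    case 4
    then show ?case by (simp add: mult_single plus_list_def flip: mult.assoc)
  next
    case 7
    show ?case
      unfolding free_algebra_simps
      by (metis single_Nil_commute mult.assoc)
  qed (simp_all add: distrib_left distrib_right single_add mult.assoc flip: one_free)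
qed

lemma complex_algebra_quotient:
  assumes "complex_algebra A" "ideal I A"
  shows "complex_algebra (quotient_algebra A I)"
    and "c \<in> carrier A \<Longrightarrow> d \<in> carrier A \<Longrightarrow> (I +>\<^bsub>A\<^esub> c) \<otimes>\<^bsub>quotient_algebra A I\<^esub> (I +>\<^bsub>A\<^esub> d) = I +>\<^bsub>A\<^esub> (c \<otimes>\<^bsub>A\<^esub> d)"
    and "c \<in> carrier A \<Longrightarrow> d \<in> carrier A \<Longrightarrow> (I +>\<^bsub>A\<^esub> c) \<oplus>\<^bsub>quotient_algebra A I\<^esub> (I +>\<^bsub>A\<^esub> d) = I +>\<^bsub>A\<^esub> (c \<oplus>\<^bsub>A\<^esub> d)"
    and "d \<in> carrier A \<Longrightarrow> k \<odot>\<^bsub>quotient_algebra A I\<^esub> (I +>\<^bsub>A\<^esub> d) = I +>\<^bsub>A\<^esub> (k \<odot>\<^bsub>A\<^esub> d)"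
    and "\<one>\<^bsub>quotient_algebra A I\<^esub> = I +>\<^bsub>A\<^esub> \<one>\<^bsub>A\<^esub>"
    and "carrier (quotient_algebra A I) = (\<lambda>a. I +>\<^bsub>A\<^esub> a) ` carrier A"
proof -
  interpret A: complex_algebra A by fact
  interpret I: ideal I A by fact
  let ?Q = "quotient_algebra A I"
  note Qd = quotient_algebra_def ring.extend_def module.fields_def
  have [simp]: "carrier ?Q = carrier (A Quot I)" "(\<otimes>\<^bsub>?Q\<^esub>) = (\<otimes>\<^bsub>A Quot I\<^esub>)" "\<one>\<^bsub>?Q\<^esub> = \<one>\<^bsub>A Quot I\<^esub>"
    "(\<oplus>\<^bsub>?Q\<^esub>) = (\<oplus>\<^bsub>A Quot I\<^esub>)" "\<zero>\<^bsub>?Q\<^esub> = \<zero>\<^bsub>A Quot I\<^esub>"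
    "\<And>c U. c \<odot>\<^bsub>?Q\<^esub> U = (I +>\<^bsub>A\<^esub> (c \<odot>\<^bsub>A\<^esub> \<one>\<^bsub>A\<^esub>)) \<otimes>\<^bsub>A Quot I\<^esub> U"
    by (simp_all add: Qd)
  have car: "carrier (A Quot I) = (\<lambda>a. I +>\<^bsub>A\<^esub> a) ` carrier A"
    by (auto simp: FactRing_def A_RCOSETS_def' )
  have mul: "(I +>\<^bsub>A\<^esub> c) \<otimes>\<^bsub>A Quot I\<^esub> (I +>\<^bsub>A\<^esub> d) = I +>\<^bsub>A\<^esub> (c \<otimes>\<^bsub>A\<^esub> d)"
    if "c \<in> carrier A" "d \<in> carrier A" for c d
    using that by (simp add: FactRing_def I.rcoset_mult_add)
  have ad: "(I +>\<^bsub>A\<^esub> c) \<oplus>\<^bsub>A Quot I\<^esub> (I +>\<^bsub>A\<^esub> d) = I +>\<^bsub>A\<^esub> (c \<oplus>\<^bsub>A\<^esub> d)"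
    if "c \<in> carrier A" "d \<in> carrier A" for c d
    using that by (simp add: FactRing_def I.a_rcos_sum)
  have sm: "(I +>\<^bsub>A\<^esub> (k \<odot>\<^bsub>A\<^esub> \<one>\<^bsub>A\<^esub>)) \<otimes>\<^bsub>A Quot I\<^esub> (I +>\<^bsub>A\<^esub> d) = I +>\<^bsub>A\<^esub> (k \<odot>\<^bsub>A\<^esub> d)"
    if "d \<in> carrier A" for k d
    using that by (simp add: mul A.smult_mult_left)
  interpret Q: ring "A Quot I" by (rule I.quotient_is_ring)
  have "ring ?Q"
  proof (rule ringI)
    show "abelian_group ?Q"
      by (rule abelian_groupI) (auto simp: Q.a_ac)
    show "Group.monoid ?Q"
      by (rule monoidI) (auto simp: Q.m_assoc)
  qed (auto simp: Q.l_distr Q.r_distr)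
  moreover have "complex_algebra_axioms ?Q"
    by unfold_locales
      (auto simp: car mul ad sm A.smult_l_distr A.smult_r_distr A.l_distr
        A.smult_mult_left A.smult_mult_right mult.commute simp flip: A.smult_assoc)
  ultimately show "complex_algebra ?Q" by (rule complex_algebra.intro)
  show "carrier ?Q = (\<lambda>a. I +>\<^bsub>A\<^esub> a) ` carrier A" by (simp add: car)
  show "\<one>\<^bsub>?Q\<^esub> = I +>\<^bsub>A\<^esub> \<one>\<^bsub>A\<^esub>" by (simp add: FactRing_def)
  show "c \<in> carrier A \<Longrightarrow> d \<in> carrier A \<Longrightarrow> (I +>\<^bsub>A\<^esub> c) \<otimes>\<^bsub>?Q\<^esub> (I +>\<^bsub>A\<^esub> d) = I +>\<^bsub>A\<^esub> (c \<otimes>\<^bsub>A\<^esub> d)"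
    "c \<in> carrier A \<Longrightarrow> d \<in> carrier A \<Longrightarrow> (I +>\<^bsub>A\<^esub> c) \<oplus>\<^bsub>?Q\<^esub> (I +>\<^bsub>A\<^esub> d) = I +>\<^bsub>A\<^esub> (c \<oplus>\<^bsub>A\<^esub> d)"
    "d \<in> carrier A \<Longrightarrow> k \<odot>\<^bsub>?Q\<^esub> (I +>\<^bsub>A\<^esub> d) = I +>\<^bsub>A\<^esub> (k \<odot>\<^bsub>A\<^esub> d)"
    by (simp_all add: mul ad A.smult_mult_left)
qed

lemma relation_ideal:
  assumes "R \<subseteq> carrier (free_algebra G)"
  shows "ideal (relation_ideal G R) (free_algebra G)" "R \<subseteq> relation_ideal G R"
proof -
  interpret complex_algebra "free_algebra G" by (rule complex_algebra_free_algebra)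
  show "ideal (relation_ideal G R) (free_algebra G)" "R \<subseteq> relation_ideal G R"
    unfolding relation_ideal_def using genideal_ideal genideal_self assms by blast+
qed

lemmas presented_simps = complex_algebra_quotient(2-)[OF complex_algebra_free_algebra
    relation_ideal(1), folded presented_algebra_def presented_class_def, simplified free_algebra_simps(2-)]

lemma complex_algebra_presented:
  "R \<subseteq> carrier (free_algebra G) \<Longrightarrow> complex_algebra (presented_algebra G R)"
  unfolding presented_algebra_def
  by (intro complex_algebra_quotient complex_algebra_free_algebra relation_ideal)

lemma presented_class_eqI:
  assumes "R \<subseteq> carrier (free_algebra G)" "f \<in> carrier (free_algebra G)" "g \<in> carrier (free_algebra G)"
    and "f - g \<in> relation_ideal G R"
  shows "presented_class G R f = presented_class G R g"
proof -
  interpret A: complex_algebra "free_algebra G" by (rule complex_algebra_free_algebra)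
  interpret ideal "relation_ideal G R" "free_algebra G" by (rule relation_ideal) fact
  have "f \<ominus>\<^bsub>free_algebra G\<^esub> g = f - g"
    using A.l_neg[OF assms(3)]
    by (simp add: A.minus_eq eq_neg_iff_add_eq_0 del: free_algebra_simps(1))
  with assms(4) show ?thesis
    unfolding presented_class_def
    using A.quotient_eq_iff_same_a_r_cos[OF is_ideal assms(2,3)] by simp
qed


section \<open>Localisation and tensor product\<close>

text \<open>
  The localisation of \<open>A\<close> at \<open>S \<subseteq> A\<close> is the universal algebra under \<open>A\<close> in which the elements
  of \<open>S\<close> become invertible (for a denominator set this is the Ore localisation). It is presented by
  one generator \<open>Inl a\<close> for each \<open>a \<in> A\<close>, subject to the relations that make \<open>a \<mapsto> Inl a\<close> a
  homomorphism of unital algebras, and one generator \<open>Inr s\<close> inverse to \<open>Inl s\<close> for each \<open>s \<in> S\<close>.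
\<close>

definition localisation_gens :: "(complex, 'a) module \<Rightarrow> 'a set \<Rightarrow> ('a + 'a) set" where
  "localisation_gens A S = Inl ` carrier A \<union> Inr ` S"

definition localisation_rels :: "(complex, 'a) module \<Rightarrow> 'a set \<Rightarrow> ('a + 'a) free_elem set" where
  "localisation_rels A S =
     {free_gen (Inl (a \<oplus>\<^bsub>A\<^esub> b)) - (free_gen (Inl a) + free_gen (Inl b)) |a b.
        a \<in> carrier A \<and> b \<in> carrier A} \<union>
     {free_gen (Inl (a \<otimes>\<^bsub>A\<^esub> b)) - free_gen (Inl a) * free_gen (Inl b) |a b.
        a \<in> carrier A \<and> b \<in> carrier A} \<union>
     {free_gen (Inl (c \<odot>\<^bsub>A\<^esub> a)) - Poly_Mapping.single [] c * free_gen (Inl a) |c a.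
        a \<in> carrier A} \<union>
     {free_gen (Inl \<one>\<^bsub>A\<^esub>) - 1} \<union>
     {free_gen (Inr s) * free_gen (Inl s) - 1 |s. s \<in> S} \<union>
     {free_gen (Inl s) * free_gen (Inr s) - 1 |s. s \<in> S}"

definition localisation ::
    "(complex, 'a) module \<Rightarrow> 'a set \<Rightarrow> (complex, ('a + 'a) free_elem set) module" where
  "localisation A S = presented_algebra (localisation_gens A S) (localisation_rels A S)"

definition localisation_map ::
    "(complex, 'a) module \<Rightarrow> 'a set \<Rightarrow> 'a \<Rightarrow> ('a + 'a) free_elem set" where
  "localisation_map A S a =
     presented_class (localisation_gens A S) (localisation_rels A S) (free_gen (Inl a))"

lemma localisation_rels_closed:
  assumes "complex_algebra A" "S \<subseteq> carrier A"
  shows "localisation_rels A S \<subseteq> carrier (free_algebra (localisation_gens A S))"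
proof -
  interpret A: complex_algebra A by fact
  let ?G = "localisation_gens A S"
  interpret F: complex_algebra "free_algebra ?G" by (rule complex_algebra_free_algebra)
  have minus: "f - g \<in> carrier (free_algebra ?G)"
    if "f \<in> carrier (free_algebra ?G)" "g \<in> carrier (free_algebra ?G)" for f g
    using that keys_diff[of f g] by fastforce
  note cl = minus F.a_closed[unfolded free_algebra_simps(5)] free_mult_closed
    F.one_closed[unfolded free_algebra_simps(3)] F.smult_closed[unfolded free_algebra_simps(6)]
  have gen: "g \<in> ?G \<Longrightarrow> free_gen g \<in> carrier (free_algebra ?G)" for g
    by (auto simp: free_gen_def)
  have "Inl a \<in> ?G" if "a \<in> carrier A" for a using that by (simp add: localisation_gens_def)
  moreover have "Inr s \<in> ?G" "Inl s \<in> ?G" if "s \<in> S" for s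
    using that assms(2) by (auto simp: localisation_gens_def)
  ultimately show ?thesis
    unfolding localisation_rels_def by (auto intro!: cl gen simp del: free_algebra_simps(1))
qed

lemma complex_algebra_localisation:
  "complex_algebra A \<Longrightarrow> S \<subseteq> carrier A \<Longrightarrow> complex_algebra (localisation A S)"
  unfolding localisation_def by (intro complex_algebra_presented localisation_rels_closed)

text \<open>
  The tensor product (as an abelian group) over \<open>A\<close> of \<open>B\<close> with a left \<open>A\<close>-module \<open>M\<close>, where the
  algebra \<open>B\<close> is a right \<open>A\<close>-module through a homomorphism \<open>\<iota>\<close> from \<open>A\<close> to \<open>B\<close>.
\<close>

definition tensor_rels :: "(complex, 'a) module \<Rightarrow> ('a \<Rightarrow> 'b) \<Rightarrow> (complex, 'b) module \<Rightarrow>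
    ('a, 'v) module \<Rightarrow> ('b \<times> 'v \<Rightarrow>\<^sub>0 int) set" where
  "tensor_rels A \<iota> B M =
     {frag_of (b \<oplus>\<^bsub>B\<^esub> b', v) - (frag_of (b, v) + frag_of (b', v)) |b b' v.
        b \<in> carrier B \<and> b' \<in> carrier B \<and> v \<in> carrier M} \<union>
     {frag_of (b, v \<oplus>\<^bsub>M\<^esub> v') - (frag_of (b, v) + frag_of (b, v')) |b v v'.
        b \<in> carrier B \<and> v \<in> carrier M \<and> v' \<in> carrier M} \<union>
     {frag_of (b \<otimes>\<^bsub>B\<^esub> \<iota> a, v) - frag_of (b, a \<odot>\<^bsub>M\<^esub> v) |b a v.
        b \<in> carrier B \<and> a \<in> carrier A \<and> v \<in> carrier M}"

definition tensor_rel_group :: "(complex, 'a) module \<Rightarrow> ('a \<Rightarrow> 'b) \<Rightarrow> (complex, 'b) module \<Rightarrow>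
    ('a, 'v) module \<Rightarrow> ('b \<times> 'v \<Rightarrow>\<^sub>0 int) set" where
  "tensor_rel_group A \<iota> B M =
     generate (free_Abelian_group (carrier B \<times> carrier M)) (tensor_rels A \<iota> B M)"

definition tensor_product :: "(complex, 'a) module \<Rightarrow> ('a \<Rightarrow> 'b) \<Rightarrow> (complex, 'b) module \<Rightarrow>
    ('a, 'v) module \<Rightarrow> ('b \<times> 'v \<Rightarrow>\<^sub>0 int) set monoid" where
  "tensor_product A \<iota> B M =
     free_Abelian_group (carrier B \<times> carrier M) Mod tensor_rel_group A \<iota> B M"

definition pure_tensor :: "(complex, 'a) module \<Rightarrow> ('a \<Rightarrow> 'b) \<Rightarrow> (complex, 'b) module \<Rightarrow>
    ('a, 'v) module \<Rightarrow> 'b \<Rightarrow> 'v \<Rightarrow> ('b \<times> 'v \<Rightarrow>\<^sub>0 int) set" where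
  "pure_tensor A \<iota> B M b v =
     tensor_rel_group A \<iota> B M #>\<^bsub>free_Abelian_group (carrier B \<times> carrier M)\<^esub> frag_of (b, v)"

definition localisation_unit ::
    "(complex, 'a) module \<Rightarrow> 'a set \<Rightarrow> ('a, 'v) module \<Rightarrow> 'v \<Rightarrow>
     (('a + 'a) free_elem set \<times> 'v \<Rightarrow>\<^sub>0 int) set" where
  "localisation_unit A S M v =
     pure_tensor A (localisation_map A S) (localisation A S) M \<one>\<^bsub>localisation A S\<^esub> v"


section \<open>The quantum torus and the quantum plane\<close>

definition generic :: "complex \<Rightarrow> bool" where
  "generic q \<longleftrightarrow> (\<forall>n > 0. q ^ n \<noteq> 1)"

datatype torus_gen = GX | GXi | GY | GYi

type_synonym torus_elem = "torus_gen free_elem set"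

definition torus_rels :: "complex \<Rightarrow> torus_gen free_elem set" where
  "torus_rels q =
     {free_gen GX * free_gen GXi - 1, free_gen GXi * free_gen GX - 1,
      free_gen GY * free_gen GYi - 1, free_gen GYi * free_gen GY - 1,
      free_gen GX * free_gen GY - Poly_Mapping.single [] q * (free_gen GY * free_gen GX)}"

definition quantum_torus :: "complex \<Rightarrow> (complex, torus_elem) module" where
  "quantum_torus q = presented_algebra UNIV (torus_rels q)"

definition torus_class :: "complex \<Rightarrow> torus_gen free_elem \<Rightarrow> torus_elem" where
  "torus_class q = presented_class UNIV (torus_rels q)"

abbreviation torus_x :: "complex \<Rightarrow> torus_elem" where
  "torus_x q \<equiv> torus_class q (free_gen GX)"

abbreviation torus_y :: "complex \<Rightarrow> torus_elem" where
  "torus_y q \<equiv> torus_class q (free_gen GY)"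

definition quantum_plane :: "complex \<Rightarrow> (complex, torus_elem) module" where
  "quantum_plane q =
     quantum_torus q\<lparr>carrier := generated_subalgebra (quantum_torus q) {torus_x q, torus_y q}\<rparr>"

definition plane_monomial :: "complex \<Rightarrow> nat \<Rightarrow> nat \<Rightarrow> torus_elem" where
  "plane_monomial q m n =
     (torus_x q [^]\<^bsub>quantum_plane q\<^esub> m) \<otimes>\<^bsub>quantum_plane q\<^esub> (torus_y q [^]\<^bsub>quantum_plane q\<^esub> n)"


lemma complex_algebra_quantum_torus: "complex_algebra (quantum_torus q)"
  unfolding quantum_torus_def by (rule complex_algebra_presented) auto

lemma torus_simps:
  "torus_class q f \<otimes>\<^bsub>quantum_torus q\<^esub> torus_class q g = torus_class q (f * g)"
  "torus_class q f \<oplus>\<^bsub>quantum_torus q\<^esub> torus_class q g = torus_class q (f + g)"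
  "c \<odot>\<^bsub>quantum_torus q\<^esub> torus_class q f = torus_class q (Poly_Mapping.single [] c * f)"
  "\<one>\<^bsub>quantum_torus q\<^esub> = torus_class q 1"
  "carrier (quantum_torus q) = range (torus_class q)"
  using presented_simps[of "torus_rels q" UNIV]
  by (auto simp: quantum_torus_def torus_class_def)

lemma torus_class_eqI: "f - g \<in> torus_rels q \<Longrightarrow> torus_class q f = torus_class q g"
  unfolding torus_class_def using relation_ideal(2)[of "torus_rels q" UNIV]
  by (intro presented_class_eqI) auto

lemma quantum_torus_relations:
  "torus_x q \<otimes>\<^bsub>quantum_torus q\<^esub> torus_class q (free_gen GXi) = \<one>\<^bsub>quantum_torus q\<^esub>"
  "torus_class q (free_gen GXi) \<otimes>\<^bsub>quantum_torus q\<^esub> torus_x q = \<one>\<^bsub>quantum_torus q\<^esub>"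
  "torus_y q \<otimes>\<^bsub>quantum_torus q\<^esub> torus_class q (free_gen GYi) = \<one>\<^bsub>quantum_torus q\<^esub>"
  "torus_class q (free_gen GYi) \<otimes>\<^bsub>quantum_torus q\<^esub> torus_y q = \<one>\<^bsub>quantum_torus q\<^esub>"
  "torus_x q \<otimes>\<^bsub>quantum_torus q\<^esub> torus_y q =
     q \<odot>\<^bsub>quantum_torus q\<^esub> (torus_y q \<otimes>\<^bsub>quantum_torus q\<^esub> torus_x q)"
  by (simp_all add: torus_simps, auto intro!: torus_class_eqI simp: torus_rels_def)

lemma complex_algebra_quantum_plane: "complex_algebra (quantum_plane q)"
proof -
  interpret complex_algebra "quantum_torus q" by (rule complex_algebra_quantum_torus)
  let ?X = "{B. subring B (quantum_torus q) \<and> (\<forall>c. \<forall>b \<in> B. c \<odot>\<^bsub>quantum_torus q\<^esub> b \<in> B) \<and>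
      {torus_x q, torus_y q} \<subseteq> B}"
  have "carrier (quantum_torus q) \<in> ?X"
    using carrier_is_subring by (simp add: torus_simps)
  then have "subring (\<Inter>?X) (quantum_torus q)"
    by (intro subring_Inter) blast+
  then have sub: "subring (carrier (quantum_plane q)) (quantum_torus q)"
    by (simp add: quantum_plane_def generated_subalgebra_def)
  have "ring (quantum_plane q)"
    using subring_is_ring[OF sub] by (simp add: quantum_plane_def)
  moreover have "complex_algebra_axioms (quantum_plane q)"
    using subringE(1)[OF sub]
    by unfold_locales
      (auto simp: quantum_plane_def smult_l_distr smult_r_distr smult_assoc smult_mult_left
        smult_mult_right subset_iff, auto simp: generated_subalgebra_def)
  ultimately show ?thesis by (rule complex_algebra.intro)
qed


section \<open>The basic module\<close>

text \<open>
  Laurent polynomials are finitely supported functions on the exponents; their product is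
  convolution and \<open>Poly_Mapping.single k c\<close> is \<open>c t\<^sup>k\<close>. The action is defined on words in the
  generators, extended linearly to the free algebra, and evaluated on representatives; it does not
  depend on their choice, see \<open>basic_smult_class\<close> below.
\<close>

type_synonym laurent = "int \<Rightarrow>\<^sub>0 complex"

text \<open>\<open>laurent_dilate q f\<close> is \<open>f(q t)\<close>.\<close>

definition laurent_dilate :: "complex \<Rightarrow> laurent \<Rightarrow> laurent" where
  "laurent_dilate q = Poly_Mapping.mapp (\<lambda>k c. q powi k * c)"

fun torus_gen_act :: "complex \<Rightarrow> torus_gen \<Rightarrow> laurent \<Rightarrow> laurent" where
  "torus_gen_act q GX f = laurent_dilate q f"
| "torus_gen_act q GXi f = laurent_dilate (inverse q) f"
| "torus_gen_act q GY f = Poly_Mapping.single 1 1 * f"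
| "torus_gen_act q GYi f = Poly_Mapping.single (-1) 1 * f"

definition torus_free_act :: "complex \<Rightarrow> torus_gen free_elem \<Rightarrow> laurent \<Rightarrow> laurent" where
  "torus_free_act q r f =
     (\<Sum>w \<in> Poly_Mapping.keys r.
        Poly_Mapping.single 0 (Poly_Mapping.lookup r w) * foldr (torus_gen_act q) w f)"

text \<open>The fields \<open>mult\<close> and \<open>one\<close> of a module record are not used.\<close>

definition basic_module :: "complex \<Rightarrow> (torus_elem, laurent) module" where
  "basic_module q =
     \<lparr>carrier = UNIV, monoid.mult = (*), one = 1, ring.zero = 0, add = (+),
      smult = (\<lambda>u f. torus_free_act q (SOME r. r \<in> u) f)\<rparr>"


lemma laurent_lookup_monomial:
  "Poly_Mapping.lookup (Poly_Mapping.single k c * f :: laurent) n = c * Poly_Mapping.lookup f (n - k)"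
proof (induction f rule: Poly_Mapping.update_induct)
  case (update f a b)
  have "Poly_Mapping.update a b f = f + Poly_Mapping.single a b"
    using update.hyps
    by (intro poly_mapping_eqI)
       (auto simp: lookup_update lookup_add lookup_single when_def in_keys_iff)
  then show ?case
    using update.IH
    by (auto simp: distrib_left mult_single lookup_add lookup_single when_def)
qed auto

lemma laurent_lookup_dilate:
  "Poly_Mapping.lookup (laurent_dilate q f) k = q powi k * Poly_Mapping.lookup f k"
  by (simp add: laurent_dilate_def lookup_mapp when_def in_keys_iff)

lemma torus_gen_act_add:
  "torus_gen_act q g (f + f') = torus_gen_act q g f + torus_gen_act q g f'"
  by (cases g; intro poly_mapping_eqI)
     (simp_all add: laurent_lookup_monomial laurent_lookup_dilate lookup_add distrib_left)

lemma torus_gen_act_scale: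
  "torus_gen_act q g (Poly_Mapping.single 0 c * f) = Poly_Mapping.single 0 c * torus_gen_act q g f"
  by (cases g; intro poly_mapping_eqI)
     (simp_all add: laurent_lookup_monomial laurent_lookup_dilate)

lemma torus_word_act_add:
  "foldr (torus_gen_act q) w (f + f') = foldr (torus_gen_act q) w f + foldr (torus_gen_act q) w f'"
  by (induction w) (simp_all add: torus_gen_act_add)

lemma torus_word_act_scale:
  "foldr (torus_gen_act q) w (Poly_Mapping.single 0 c * f) =
     Poly_Mapping.single 0 c * foldr (torus_gen_act q) w f"
  by (induction w) (simp_all add: torus_gen_act_scale)

lemma torus_free_act_superset:
  assumes "finite W" "Poly_Mapping.keys r \<subseteq> W"
  shows "torus_free_act q r f =
    (\<Sum>w \<in> W. Poly_Mapping.single 0 (Poly_Mapping.lookup r w) * foldr (torus_gen_act q) w f)"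
  unfolding torus_free_act_def using assms
  by (intro sum.mono_neutral_left) (auto simp: in_keys_iff)

lemma torus_free_act_add_left:
  "torus_free_act q (r + s) f = torus_free_act q r f + torus_free_act q s f"
proof -
  let ?W = "Poly_Mapping.keys r \<union> Poly_Mapping.keys s"
  have "Poly_Mapping.keys (r + s) \<subseteq> ?W" by (rule Poly_Mapping.keys_add)
  then show ?thesis
    by (simp add: torus_free_act_superset[of ?W] lookup_add single_add distrib_right sum.distrib)
qed

lemma torus_free_act_add_right:
  "torus_free_act q r (f + f') = torus_free_act q r f + torus_free_act q r f'"
  by (simp add: torus_free_act_def torus_word_act_add distrib_left sum.distrib)

lemma torus_free_act_scale:
  "torus_free_act q r (Poly_Mapping.single 0 c * f) = Poly_Mapping.single 0 c * torus_free_act q r f"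
  by (simp add: torus_free_act_def torus_word_act_scale sum_distrib_left mult.left_commute)

lemma torus_free_act_single:
  "torus_free_act q (Poly_Mapping.single w c) f = Poly_Mapping.single 0 c * foldr (torus_gen_act q) w f"
  by (simp add: torus_free_act_superset[of "{w}"])

lemma free_elem_induct [case_names zero single add]:
  fixes f :: "'g free_elem"
  assumes "P 0" "\<And>w c. P (Poly_Mapping.single w c)" "\<And>f g. P f \<Longrightarrow> P g \<Longrightarrow> P (f + g)"
  shows "P f"
proof (induction f rule: Poly_Mapping.update_induct)
  case (update f a b)
  have "Poly_Mapping.update a b f = f + Poly_Mapping.single a b"
    using update.hyps
    by (intro poly_mapping_eqI)
       (auto simp: lookup_update lookup_add lookup_single when_def in_keys_iff)
  then show ?case using update.IH assms by simp
qed (fact assms)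

lemma torus_free_act_zero [simp]: "torus_free_act q 0 f = 0"
  by (simp add: torus_free_act_def)

lemma torus_free_act_mult:
  "torus_free_act q (r * s) f = torus_free_act q r (torus_free_act q s f)"
proof (induction r rule: free_elem_induct)
  case zero
  then show ?case by simp
next
  case (single w c)
  show ?case
  proof (induction s rule: free_elem_induct)
    case zero
    have "torus_free_act q (Poly_Mapping.single w c) 0 = 0"
      using torus_free_act_add_right[of q "Poly_Mapping.single w c" 0 0] by simp
    then show ?case by simp
  next
    case (single v d)
    show ?case
      by (simp add: mult_single plus_list_def torus_free_act_single torus_word_act_scale
            flip: mult.assoc)
  next
    case (add s s')
    then show ?case by (simp add: distrib_left torus_free_act_add_left torus_free_act_add_right)
  qed
next
  case (add r r')
  then show ?case by (simp add: distrib_right torus_free_act_add_left)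
qed

lemma torus_free_act_minus: "torus_free_act q (r - s) f = torus_free_act q r f - torus_free_act q s f"
  using torus_free_act_add_left[of q "r - s" s f] by simp

lemma torus_free_act_one [simp]: "torus_free_act q 1 f = f"
  by (simp add: one_free torus_free_act_single)

lemma torus_free_act_rels:
  assumes "q \<noteq> 0" "r \<in> torus_rels q"
  shows "torus_free_act q r f = 0"
  using assms(2)[unfolded torus_rels_def] assms(1)
  by (elim insertE emptyE; hypsubst; intro poly_mapping_eqI)
     (simp_all add: free_gen_def torus_free_act_minus torus_free_act_mult torus_free_act_single
        laurent_lookup_monomial laurent_lookup_dilate lookup_minus power_int_diff power_int_inverse)

lemma torus_free_act_ideal:
  assumes "q \<noteq> 0" "r \<in> relation_ideal UNIV (torus_rels q)"
  shows "torus_free_act q r f = 0"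
proof -
  interpret F: complex_algebra "free_algebra UNIV :: (complex, torus_gen free_elem) module"
    by (rule complex_algebra_free_algebra)
  let ?K = "{r. \<forall>f. torus_free_act q r f = 0}"
  have z: "torus_free_act q r 0 = 0" for r
    using torus_free_act_add_right[of q r 0 0] by simp
  have "ideal ?K (free_algebra UNIV)"
  proof (rule idealI)
    show "subgroup ?K (add_monoid (free_algebra UNIV))"
    proof (rule F.add.subgroupI)
      fix a assume a: "a \<in> ?K"
      have "\<ominus>\<^bsub>free_algebra UNIV\<^esub> a = - a"
        using F.minus_unique[of "\<ominus>\<^bsub>free_algebra UNIV\<^esub> a" a "- a"] F.l_neg[of a] by simp
      then show "\<ominus>\<^bsub>free_algebra UNIV\<^esub> a \<in> ?K"
        using a torus_free_act_minus[of q 0 a] by simp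
    qed (auto simp: torus_free_act_add_left intro: exI[of _ 0])
  qed (auto simp: F.ring_axioms torus_free_act_mult z)
  moreover have "torus_rels q \<subseteq> ?K" using torus_free_act_rels assms(1) by blast
  ultimately show ?thesis
    using F.genideal_minimal assms(2) unfolding relation_ideal_def by blast
qed

lemma basic_smult_class:
  assumes "q \<noteq> 0"
  shows "torus_class q r \<odot>\<^bsub>basic_module q\<^esub> f = torus_free_act q r f"
proof -
  interpret F: complex_algebra "free_algebra UNIV :: (complex, torus_gen free_elem) module"
    by (rule complex_algebra_free_algebra)
  interpret ideal "relation_ideal UNIV (torus_rels q)" "free_algebra UNIV"
    by (rule relation_ideal) auto
  have "r \<in> torus_class q r"
    unfolding torus_class_def presented_class_def by (rule a_rcos_self) simp
  then have "(SOME s. s \<in> torus_class q r) \<in> torus_class q r" by (rule someI)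
  then obtain h where "h \<in> relation_ideal UNIV (torus_rels q)"
      "(SOME s. s \<in> torus_class q r) = h + r"
    by (auto simp: torus_class_def presented_class_def a_r_coset_def')
  then show ?thesis
    using torus_free_act_ideal[OF assms] by (simp add: basic_module_def torus_free_act_add_left)
qed

lemma left_module_basic:
  assumes "q \<noteq> 0"
  shows "left_module (quantum_torus q) (basic_module q)"
proof -
  interpret complex_algebra "quantum_torus q" by (rule complex_algebra_quantum_torus)
  have [simp]: "carrier (basic_module q) = UNIV" "(\<oplus>\<^bsub>basic_module q\<^esub>) = (+)"
    "\<zero>\<^bsub>basic_module q\<^esub> = 0"
    by (simp_all add: basic_module_def)
  have "abelian_group (basic_module q)"
    by (rule abelian_groupI) (auto simp: add_ac intro: exI[of _ "- x" for x])
  then show ?thesis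
    using ring_axioms
    by (intro left_module.intro left_module_axioms.intro)
      (auto simp: torus_simps basic_smult_class[OF assms] torus_free_act_add_left
        torus_free_act_add_right torus_free_act_mult)
qed

lemma basic_module_action:
  assumes "q \<noteq> 0"
  shows "Poly_Mapping.lookup (torus_x q \<odot>\<^bsub>basic_module q\<^esub> f) k = q powi k * Poly_Mapping.lookup f k"
    and "torus_y q \<odot>\<^bsub>basic_module q\<^esub> f = Poly_Mapping.single 1 1 * f"
    and "(c \<odot>\<^bsub>quantum_torus q\<^esub> \<one>\<^bsub>quantum_torus q\<^esub>) \<odot>\<^bsub>basic_module q\<^esub> f = Poly_Mapping.single 0 c * f"
  by (simp_all add: torus_simps basic_smult_class[OF assms] torus_free_act_single free_gen_def
        laurent_lookup_dilate)


section \<open>Admissible modules\<close>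

definition locally_D_finite :: "complex \<Rightarrow> nat \<Rightarrow> nat \<Rightarrow> (torus_elem, 'v) module \<Rightarrow> bool" where
  "locally_D_finite q m n M \<longleftrightarrow>
     left_module (quantum_plane q) M \<and> locally_finite (quantum_plane q) (plane_monomial q m n) M"

definition xy_powers :: "complex \<Rightarrow> torus_elem set" where
  "xy_powers q =
     {(torus_x q \<otimes>\<^bsub>quantum_plane q\<^esub> torus_y q) [^]\<^bsub>quantum_plane q\<^esub> k |k :: nat. True}"

definition kappa :: "complex \<Rightarrow> (torus_elem, 'v) module \<Rightarrow> 'v \<Rightarrow>
    ((torus_elem + torus_elem) free_elem set \<times> 'v \<Rightarrow>\<^sub>0 int) set" where
  "kappa q M = localisation_unit (quantum_plane q) (xy_powers q) M"

definition admissible :: "complex \<Rightarrow> (torus_elem, 'v) module \<Rightarrow> bool" where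
  "admissible q M \<longleftrightarrow> left_module (quantum_plane q) M \<and>
     (\<exists>(k :: nat) N (m :: nat \<Rightarrow> nat) (n :: nat \<Rightarrow> nat).
        (\<forall>j < k. submodule (N j) (quantum_plane q) M \<and> (m j, n j) \<noteq> (0, 0) \<and>
                 locally_D_finite q (m j) (n j) (M\<lparr>carrier := N j\<rparr>)) \<and>
        carrier M = {\<Oplus>\<^bsub>M\<^esub>j\<in>{..<k}. v j |v. \<forall>j < k. v j \<in> N j}) \<and>
     inj_on (kappa q M) (carrier M)"

definition simple_admissible :: "complex \<Rightarrow> (torus_elem, 'v) module \<Rightarrow> bool" where
  "simple_admissible q M \<longleftrightarrow> admissible q M \<and> simple_module (quantum_plane q) M"

end

(*
  If M is simple and admissible, one of the submodules M_j is all of M, so some monomial D = x^m y^n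
  acts locally finitely and, C being algebraically closed, has an eigenvector. Injectivity of kappa
  makes x and y injective; since xM and yM are submodules, x and y are bijective and M becomes a
  simple module over the quantum torus. Twisting by the automorphisms (x, y) -> (x, xy), (xy, y)
  and (y, 1/x) runs Euclid's algorithm on (m, n), until x itself has an eigenvector w. Then
  f(t) -> f(y) w is, after rescaling x, an isomorphism from the basic module onto M: it is injective
  because the y^k w have distinct x-eigenvalues, and surjective because M is simple.
*)

theory Submission
  imports Defs "HOL-Computational_Algebra.Fundamental_Theorem_Algebra"
begin

section \<open>Operators satisfying the torus relations\<close>

text \<open>The torus is a quotient of a free algebra, so an action of it, or a homomorphism out of
  it, is given on words and must then be shown to kill the ideal of relations. The locale below does
  this once and serves twice: for left multiplications on the torus itself, which produce the
  automorphisms, and for the operators x, y and their inverses on M, which extend the action from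
  the plane to the torus.

  Injectivity of kappa is used on one element: if s = xy kills v, then 1 (x) v = s^-1 (x) s v = s^-1
  (x) 0 = 1 (x) 0. The images xM and yM are submodules because x and y are normal elements: moving a
  generator past them only costs a power of q.

  A shear keeps the eigenvector. In the module twisted by (x, xy) the monomial x^(m-n) y^n acts as a
  scalar multiple of x^m y^n, so the same w serves throughout and only its eigenvalue changes. The
  algorithm ends at x^d with d the gcd of the exponents, so the factorisation that gives D an
  eigenvector is applied a second time, to X^d - \<mu>. Genericity enters only in separating the
  eigenvalues of x.\<close>

locale torus_operators = abelian_group M for M :: "('v, 'm) ring_scheme" (structure) +
  fixes q :: complex and sc :: "complex \<Rightarrow> 'v \<Rightarrow> 'v" and act :: "torus_gen \<Rightarrow> 'v \<Rightarrow> 'v"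
  assumes sc_closed [simp, intro]: "v \<in> carrier M \<Longrightarrow> sc c v \<in> carrier M"
    and sc_add_left: "v \<in> carrier M \<Longrightarrow> sc (c + d) v = sc c v \<oplus> sc d v"
    and sc_add_right: "v \<in> carrier M \<Longrightarrow> w \<in> carrier M \<Longrightarrow> sc c (v \<oplus> w) = sc c v \<oplus> sc c w"
    and sc_mult: "v \<in> carrier M \<Longrightarrow> sc (c * d) v = sc c (sc d v)"
    and sc_one [simp]: "v \<in> carrier M \<Longrightarrow> sc 1 v = v"
    and act_closed [simp, intro]: "v \<in> carrier M \<Longrightarrow> act g v \<in> carrier M"
    and act_add: "v \<in> carrier M \<Longrightarrow> w \<in> carrier M \<Longrightarrow> act g (v \<oplus> w) = act g v \<oplus> act g w"
    and act_sc: "v \<in> carrier M \<Longrightarrow> act g (sc c v) = sc c (act g v)"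
    and act_inverse:
      "v \<in> carrier M \<Longrightarrow> act GX (act GXi v) = v" "v \<in> carrier M \<Longrightarrow> act GXi (act GX v) = v"
      "v \<in> carrier M \<Longrightarrow> act GY (act GYi v) = v" "v \<in> carrier M \<Longrightarrow> act GYi (act GY v) = v"
    and act_commute: "v \<in> carrier M \<Longrightarrow> act GX (act GY v) = sc q (act GY (act GX v))"
begin

definition word_act :: "torus_gen list \<Rightarrow> 'v \<Rightarrow> 'v" where
  "word_act w v = foldr act w v"

definition free_act :: "torus_gen free_elem \<Rightarrow> 'v \<Rightarrow> 'v" where
  "free_act r v = (\<Oplus>w\<in>Poly_Mapping.keys r. sc (Poly_Mapping.lookup r w) (word_act w v))"

text \<open>The choice of representative is immaterial, because the ideal of relations acts as zero
  (\<open>free_act_ideal\<close>).\<close>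

definition torus_act :: "torus_elem \<Rightarrow> 'v \<Rightarrow> 'v" where
  "torus_act u v = free_act (SOME r. r \<in> u) v"

lemma sc_zero [simp]: "v \<in> carrier M \<Longrightarrow> sc 0 v = \<zero>"
  using sc_add_left[of v 0 0] add.r_cancel_one[of "sc 0 v" "sc 0 v"] by simp

lemma word_act_closed [simp, intro]: "v \<in> carrier M \<Longrightarrow> word_act w v \<in> carrier M"
  by (induction w) (simp_all add: word_act_def)

lemma word_act_simps [simp]:
  "word_act [] v = v" "word_act (g # w) v = act g (word_act w v)"
  "word_act (w @ w') v = word_act w (word_act w' v)"
  by (simp_all add: word_act_def)

lemma word_act_add:
  "v \<in> carrier M \<Longrightarrow> v' \<in> carrier M \<Longrightarrow> word_act w (v \<oplus> v') = word_act w v \<oplus> word_act w v'"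
  by (induction w) (simp_all add: act_add)

lemma word_act_sc: "v \<in> carrier M \<Longrightarrow> word_act w (sc c v) = sc c (word_act w v)"
  by (induction w) (simp_all add: act_sc)

lemma free_act_superset:
  assumes "finite W" "Poly_Mapping.keys r \<subseteq> W" "v \<in> carrier M"
  shows "free_act r v = (\<Oplus>w\<in>W. sc (Poly_Mapping.lookup r w) (word_act w v))"
  unfolding free_act_def using assms
  by (intro add.finprod_mono_neutral_cong_left) (auto simp: in_keys_iff)

lemma free_act_closed [simp, intro]: "v \<in> carrier M \<Longrightarrow> free_act r v \<in> carrier M"
  unfolding free_act_def by (intro finsum_closed) auto

lemma free_act_add_left:
  assumes "v \<in> carrier M"
  shows "free_act (r + s) v = free_act r v \<oplus> free_act s v"
proof -
  let ?W = "Poly_Mapping.keys r \<union> Poly_Mapping.keys s"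
  have "Poly_Mapping.keys (r + s) \<subseteq> ?W" by (rule Poly_Mapping.keys_add)
  then have "free_act (r + s) v =
      (\<Oplus>w\<in>?W. sc (Poly_Mapping.lookup r w) (word_act w v) \<oplus> sc (Poly_Mapping.lookup s w) (word_act w v))"
    using assms by (simp add: free_act_superset[of ?W] lookup_add sc_add_left)
  also have "\<dots> = free_act r v \<oplus> free_act s v"
    using assms by (subst finsum_addf) (auto simp: free_act_superset[of ?W])
  finally show ?thesis .
qed

lemma free_act_add_right:
  assumes "v \<in> carrier M" "v' \<in> carrier M"
  shows "free_act r (v \<oplus> v') = free_act r v \<oplus> free_act r v'"
proof -
  have "free_act r (v \<oplus> v') = (\<Oplus>w\<in>Poly_Mapping.keys r.
      sc (Poly_Mapping.lookup r w) (word_act w v) \<oplus> sc (Poly_Mapping.lookup r w) (word_act w v'))"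
    using assms unfolding free_act_def
    by (intro finsum_cong') (auto simp: word_act_add sc_add_right)
  also have "\<dots> = free_act r v \<oplus> free_act r v'"
    using assms unfolding free_act_def by (subst finsum_addf) auto
  finally show ?thesis .
qed

lemma free_act_single [simp]:
  assumes "v \<in> carrier M"
  shows "free_act (Poly_Mapping.single w c) v = sc c (word_act w v)"
  using assms by (simp add: free_act_superset[of "{w}"] finsum_insert)

lemma free_act_gen: "v \<in> carrier M \<Longrightarrow> free_act (free_gen g) v = act g v"
  by (simp add: free_gen_def)

lemma free_act_one [simp]: "v \<in> carrier M \<Longrightarrow> free_act 1 v = v"
  unfolding one_free by simp

lemma free_act_zero [simp]: "free_act 0 v = \<zero>"
  by (simp add: free_act_def)

lemma free_act_of_zero [simp]: "free_act r \<zero> = \<zero>"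
  using free_act_add_right[of \<zero> \<zero> r] add.r_cancel_one[of "free_act r \<zero>" "free_act r \<zero>"] by simp

lemma free_act_mult:
  assumes "v \<in> carrier M"
  shows "free_act (r * s) v = free_act r (free_act s v)"
proof (induction r rule: free_elem_induct)
  case (single w c)
  show ?case
  proof (induction s rule: free_elem_induct)
    case (single w' d)
    show ?case
      using assms by (simp add: mult_single plus_list_def word_act_sc sc_mult)
  qed (use assms in \<open>simp_all add: distrib_left free_act_add_left free_act_add_right del: free_act_single\<close>)
qed (use assms in \<open>simp_all add: distrib_right free_act_add_left\<close>)

lemma free_act_diff_eq_zero:
  assumes "v \<in> carrier M" "free_act r v = free_act s v"
  shows "free_act (r - s) v = \<zero>"
  using free_act_add_left[of v "r - s" s] assms
    add.r_cancel_one'[of "free_act s v" "free_act (r - s) v"] by simp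

lemma free_act_rels:
  assumes "r \<in> torus_rels q" "v \<in> carrier M"
  shows "free_act r v = \<zero>"
  using assms(1)[unfolded torus_rels_def] assms(2)
  by (elim insertE emptyE; hypsubst; intro free_act_diff_eq_zero)
     (simp_all add: free_gen_def one_free free_act_mult act_inverse act_commute mult_single plus_list_def)

text \<open>The elements of the free algebra that kill every vector form a two-sided ideal. It
  contains the relations, hence the ideal that they generate.\<close>

lemma free_act_ideal:
  assumes "r \<in> relation_ideal UNIV (torus_rels q)" "v \<in> carrier M"
  shows "free_act r v = \<zero>"
proof -
  interpret F: complex_algebra "free_algebra UNIV :: (complex, torus_gen free_elem) module"
    by (rule complex_algebra_free_algebra)
  let ?K = "{r. \<forall>v\<in>carrier M. free_act r v = \<zero>}"
  have "ideal ?K (free_algebra UNIV)"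
  proof (rule idealI)
    show "subgroup ?K (add_monoid (free_algebra UNIV))"
    proof (rule F.add.subgroupI)
      fix a assume a: "a \<in> ?K"
      have "\<ominus>\<^bsub>free_algebra UNIV\<^esub> a = 0 - a"
        using F.minus_unique[of "\<ominus>\<^bsub>free_algebra UNIV\<^esub> a" a "- a"] F.l_neg[of a] by simp
      then show "\<ominus>\<^bsub>free_algebra UNIV\<^esub> a \<in> ?K"
        using a by (auto intro: free_act_diff_eq_zero simp del: diff_0)
    qed (auto simp: free_act_add_left intro: exI[of _ 0])
  qed (auto simp: F.ring_axioms free_act_mult)
  moreover have "torus_rels q \<subseteq> ?K" using free_act_rels by blast
  ultimately show ?thesis
    using F.genideal_minimal assms unfolding relation_ideal_def by blast
qed

lemma torus_act_class:
  assumes "v \<in> carrier M"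
  shows "torus_act (torus_class q r) v = free_act r v"
proof -
  interpret F: complex_algebra "free_algebra UNIV :: (complex, torus_gen free_elem) module"
    by (rule complex_algebra_free_algebra)
  interpret ideal "relation_ideal UNIV (torus_rels q)" "free_algebra UNIV"
    by (rule relation_ideal) auto
  have "r \<in> torus_class q r"
    unfolding torus_class_def presented_class_def by (rule a_rcos_self) simp
  then have "(SOME s. s \<in> torus_class q r) \<in> torus_class q r" by (rule someI)
  then obtain h where "h \<in> relation_ideal UNIV (torus_rels q)"
      "(SOME s. s \<in> torus_class q r) = h + r"
    by (auto simp: torus_class_def presented_class_def a_r_coset_def')
  then show ?thesis
    using free_act_ideal assms by (simp add: torus_act_def free_act_add_left)
qed

text \<open>The locale takes \<open>M\<close> to be any record that extends a ring, so that both the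
  torus and a module can play its part. \<open>N\<close> carries the same additive group in the
  record type whose scalars are torus elements.\<close>

lemma torus_act_left_module:
  fixes N :: "(torus_elem, 'v) module"
  assumes "carrier N = carrier M" "add N = add M" "ring.zero N = \<zero>"
  shows "left_module (quantum_torus q) (N\<lparr>smult := torus_act\<rparr>)"
proof -
  interpret L: complex_algebra "quantum_torus q" by (rule complex_algebra_quantum_torus)
  have "abelian_group (N\<lparr>smult := torus_act\<rparr>)"
    using assms by (intro abelian_groupI) (auto simp: a_ac)
  moreover have "left_module_axioms (quantum_torus q) (N\<lparr>smult := torus_act\<rparr>)"
  proof (rule left_module_axioms.intro, goal_cases)
    case (1 a v)
    then obtain r where "a = torus_class q r" by (auto simp only: torus_simps)
    with 1 show ?case by (simp add: assms torus_act_class)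
  next
    case (2 a b v)
    then obtain r s where "a = torus_class q r" "b = torus_class q s" by (auto simp only: torus_simps)
    with 2 show ?case by (simp add: assms torus_simps torus_act_class free_act_add_left)
  next
    case (3 a v w)
    then obtain r where "a = torus_class q r" by (auto simp only: torus_simps)
    with 3 show ?case by (simp add: assms torus_act_class free_act_add_right)
  next
    case (4 a b v)
    then obtain r s where "a = torus_class q r" "b = torus_class q s" by (auto simp only: torus_simps)
    with 4 show ?case by (simp add: assms torus_simps torus_act_class free_act_mult)
  next
    case (5 v)
    then show ?case by (simp add: assms torus_simps torus_act_class)
  qed
  ultimately show ?thesis
    using L.ring_axioms by (intro left_module.intro)
qed

end

section \<open>Endomorphisms of the quantum torus\<close>

lemma torus_word_Cons:
  "torus_class q (Poly_Mapping.single (g # w) 1) =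
     torus_class q (free_gen g) \<otimes>\<^bsub>quantum_torus q\<^esub> torus_class q (Poly_Mapping.single w 1)"
  by (simp add: torus_simps free_gen_def mult_single plus_list_def)

text \<open>Every class is represented by a linear combination of words, and a word is a product of
  generators. The inverses count as generators, so \<open>gen\<close> covers all four of them; zero
  is the empty word with coefficient 0.\<close>

lemma torus_induct [consumes 1, case_names gen one scale add mult]:
  assumes "u \<in> carrier (quantum_torus q)"
    and gen: "\<And>g. P (torus_class q (free_gen g))"
    and one: "P \<one>\<^bsub>quantum_torus q\<^esub>"
    and scale: "\<And>c u. u \<in> carrier (quantum_torus q) \<Longrightarrow> P u \<Longrightarrow> P (c \<odot>\<^bsub>quantum_torus q\<^esub> u)"
    and add: "\<And>u v. u \<in> carrier (quantum_torus q) \<Longrightarrow> v \<in> carrier (quantum_torus q) \<Longrightarrow>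
      P u \<Longrightarrow> P v \<Longrightarrow> P (u \<oplus>\<^bsub>quantum_torus q\<^esub> v)"
    and mult: "\<And>u v. u \<in> carrier (quantum_torus q) \<Longrightarrow> v \<in> carrier (quantum_torus q) \<Longrightarrow>
      P u \<Longrightarrow> P v \<Longrightarrow> P (u \<otimes>\<^bsub>quantum_torus q\<^esub> v)"
  shows "P u"
proof -
  have cl: "torus_class q r \<in> carrier (quantum_torus q)" for r by (simp add: torus_simps)
  have word: "P (torus_class q (Poly_Mapping.single w 1))" for w
  proof (induction w)
    case Nil
    then show ?case using one by (simp add: torus_simps one_free)
  next
    case (Cons g w)
    then show ?case using mult[OF cl cl gen] by (simp add: torus_word_Cons)
  qed
  have single: "P (torus_class q (Poly_Mapping.single w c))" for w c
    using scale[OF cl word, of c w] by (simp add: torus_simps mult_single plus_list_def)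
  have "P (torus_class q r)" for r
  proof (induction r rule: free_elem_induct)
    case zero
    then show ?case using single[of "[]" 0] by simp
  next
    case (add r s)
    then show ?case using assms(5)[OF cl cl] by (simp add: torus_simps)
  qed (rule single)
  then show ?thesis using assms(1) by (auto simp: torus_simps)
qed

lemma torus_class_closed [simp, intro]: "torus_class q r \<in> carrier (quantum_torus q)"
  by (simp add: torus_simps)

definition algebra_endomorphism :: "(complex, 'a) module \<Rightarrow> ('a \<Rightarrow> 'a) \<Rightarrow> bool" where
  "algebra_endomorphism A \<phi> \<longleftrightarrow>
     \<phi> \<in> ring_hom A A \<and> (\<forall>c. \<forall>a \<in> carrier A. \<phi> (c \<odot>\<^bsub>A\<^esub> a) = c \<odot>\<^bsub>A\<^esub> \<phi> a)"

lemma algebra_endomorphism_comp: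
  assumes "algebra_endomorphism A \<phi>" "algebra_endomorphism A \<psi>"
  shows "algebra_endomorphism A (\<phi> \<circ> \<psi>)"
  using assms ring_hom_trans[of \<psi> A A \<phi> A]
  by (auto simp: algebra_endomorphism_def ring_hom_closed)

lemma algebra_automorphisms_comp:
  assumes "\<phi> \<in> algebra_automorphisms A" "\<psi> \<in> algebra_automorphisms A"
  shows "\<phi> \<circ> \<psi> \<in> algebra_automorphisms A"
proof -
  have "\<phi> \<circ> \<psi> \<in> ring_iso A A"
    using assms ring_iso_set_trans[of \<psi> A A \<phi> A] by (simp add: algebra_automorphisms_def)
  moreover have "\<psi> a \<in> carrier A" if "a \<in> carrier A" for a
    using assms(2) that by (auto simp: algebra_automorphisms_def ring_iso_def ring_hom_def)
  ultimately show ?thesis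
    using assms by (simp add: algebra_automorphisms_def)
qed

lemma algebra_automorphisms_inv:
  assumes "complex_algebra A" "\<phi> \<in> algebra_automorphisms A"
  shows "inv_into (carrier A) \<phi> \<in> algebra_automorphisms A"
proof -
  interpret complex_algebra A by fact
  have iso: "\<phi> \<in> ring_iso A A" and lin: "\<And>c a. a \<in> carrier A \<Longrightarrow> \<phi> (c \<odot>\<^bsub>A\<^esub> a) = c \<odot>\<^bsub>A\<^esub> \<phi> a"
    using assms(2) by (auto simp: algebra_automorphisms_def)
  have bij: "bij_betw \<phi> (carrier A) (carrier A)" using iso by (simp add: ring_iso_def)
  let ?\<psi> = "inv_into (carrier A) \<phi>"
  have "?\<psi> (c \<odot>\<^bsub>A\<^esub> a) = c \<odot>\<^bsub>A\<^esub> ?\<psi> a" if a: "a \<in> carrier A" for c a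
  proof -
    have cl: "?\<psi> a \<in> carrier A" and eq: "\<phi> (?\<psi> a) = a"
      using a bij by (auto simp: bij_betw_def f_inv_into_f inv_into_into)
    have "?\<psi> (c \<odot>\<^bsub>A\<^esub> a) = ?\<psi> (\<phi> (c \<odot>\<^bsub>A\<^esub> ?\<psi> a))" using cl eq lin by simp
    also have "\<dots> = c \<odot>\<^bsub>A\<^esub> ?\<psi> a" using cl bij by (simp add: bij_betw_def)
    finally show ?thesis .
  qed
  moreover have "?\<psi> \<in> ring_iso A A" using ring_iso_set_sym[OF ring_axioms iso] .
  ultimately show ?thesis by (simp add: algebra_automorphisms_def)
qed

section \<open>Normal ordering, homomorphisms and automorphisms of the torus\<close>

locale torus_algebra =
  fixes q :: complex
  assumes q_nonzero: "q \<noteq> 0"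
begin

abbreviation "L \<equiv> quantum_torus q"
abbreviation "x \<equiv> torus_x q"
abbreviation "y \<equiv> torus_y q"
abbreviation "xi \<equiv> torus_class q (free_gen GXi)"
abbreviation "yi \<equiv> torus_class q (free_gen GYi)"

sublocale complex_algebra L by (rule complex_algebra_quantum_torus)

text \<open>The relation between \<open>a\<close> and \<open>b\<close> is multiplied by
  \<open>ai\<close> from both sides.\<close>

lemma commute_inverse:
  assumes "a \<in> carrier L" "ai \<in> carrier L" "b \<in> carrier L"
    and "a \<otimes>\<^bsub>L\<^esub> b = c \<odot>\<^bsub>L\<^esub> (b \<otimes>\<^bsub>L\<^esub> a)" "a \<otimes>\<^bsub>L\<^esub> ai = \<one>\<^bsub>L\<^esub>" "ai \<otimes>\<^bsub>L\<^esub> a = \<one>\<^bsub>L\<^esub>"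
  shows "b \<otimes>\<^bsub>L\<^esub> ai = c \<odot>\<^bsub>L\<^esub> (ai \<otimes>\<^bsub>L\<^esub> b)"
proof -
  have "b \<otimes>\<^bsub>L\<^esub> ai = ai \<otimes>\<^bsub>L\<^esub> (a \<otimes>\<^bsub>L\<^esub> b) \<otimes>\<^bsub>L\<^esub> ai"
    using assms(1,2,3,6) by (simp flip: m_assoc)
  also have "\<dots> = c \<odot>\<^bsub>L\<^esub> (ai \<otimes>\<^bsub>L\<^esub> b \<otimes>\<^bsub>L\<^esub> (a \<otimes>\<^bsub>L\<^esub> ai))"
    using assms(1-3) by (simp add: assms(4) smult_mult_left smult_mult_right m_assoc)
  finally show ?thesis using assms by simp
qed

lemma normal_order:
  "y \<otimes>\<^bsub>L\<^esub> x = inverse q \<odot>\<^bsub>L\<^esub> (x \<otimes>\<^bsub>L\<^esub> y)" "y \<otimes>\<^bsub>L\<^esub> xi = q \<odot>\<^bsub>L\<^esub> (xi \<otimes>\<^bsub>L\<^esub> y)"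
  "yi \<otimes>\<^bsub>L\<^esub> x = q \<odot>\<^bsub>L\<^esub> (x \<otimes>\<^bsub>L\<^esub> yi)" "yi \<otimes>\<^bsub>L\<^esub> xi = inverse q \<odot>\<^bsub>L\<^esub> (xi \<otimes>\<^bsub>L\<^esub> yi)"
proof -
  note rels = quantum_torus_relations[of q]
  have flip: "v = inverse c \<odot>\<^bsub>L\<^esub> u" if "u = c \<odot>\<^bsub>L\<^esub> v" "v \<in> carrier L" "c \<noteq> 0" for u v c
    using that by (simp flip: smult_assoc)
  show 1: "y \<otimes>\<^bsub>L\<^esub> x = inverse q \<odot>\<^bsub>L\<^esub> (x \<otimes>\<^bsub>L\<^esub> y)"
    by (rule flip) (simp_all add: rels q_nonzero)
  show 2: "y \<otimes>\<^bsub>L\<^esub> xi = q \<odot>\<^bsub>L\<^esub> (xi \<otimes>\<^bsub>L\<^esub> y)"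
    by (rule commute_inverse[of x]) (simp_all add: rels)
  show "yi \<otimes>\<^bsub>L\<^esub> x = q \<odot>\<^bsub>L\<^esub> (x \<otimes>\<^bsub>L\<^esub> yi)"
    using flip[OF commute_inverse[OF _ _ _ 1 rels(3,4)]] by (simp add: q_nonzero)
  show "yi \<otimes>\<^bsub>L\<^esub> xi = inverse q \<odot>\<^bsub>L\<^esub> (xi \<otimes>\<^bsub>L\<^esub> yi)"
    using flip[OF commute_inverse[OF _ _ _ 2 rels(3,4)]] by (simp add: q_nonzero)
qed

lemma prefix:
  assumes "a \<otimes>\<^bsub>L\<^esub> b = c \<odot>\<^bsub>L\<^esub> (d \<otimes>\<^bsub>L\<^esub> e)" "a \<in> carrier L" "b \<in> carrier L" "d \<in> carrier L" "e \<in> carrier L"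
    "u \<in> carrier L"
  shows "a \<otimes>\<^bsub>L\<^esub> (b \<otimes>\<^bsub>L\<^esub> u) = c \<odot>\<^bsub>L\<^esub> (d \<otimes>\<^bsub>L\<^esub> (e \<otimes>\<^bsub>L\<^esub> u))"
  using assms by (simp add: smult_mult_left flip: m_assoc)

lemma prefix_one:
  assumes "a \<otimes>\<^bsub>L\<^esub> b = \<one>\<^bsub>L\<^esub>" "a \<in> carrier L" "b \<in> carrier L" "u \<in> carrier L"
  shows "a \<otimes>\<^bsub>L\<^esub> (b \<otimes>\<^bsub>L\<^esub> u) = u"
  using assms by (simp flip: m_assoc)

text \<open>A rewriting system that moves \<open>x\<close> and \<open>xi\<close> to the left of
  \<open>y\<close> and \<open>yi\<close>, cancels inverse pairs and pulls scalars out. The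
  \<open>prefix\<close> variants are there because \<open>m_assoc\<close> nests products to the
  right, where a pair to be exchanged is usually followed by a further factor.\<close>

lemmas torus_normalise = quantum_torus_relations(1-4) normal_order
  quantum_torus_relations(1-4)[THEN prefix_one, OF torus_class_closed torus_class_closed]
  normal_order[THEN prefix, OF torus_class_closed torus_class_closed torus_class_closed torus_class_closed]
  smult_mult_left smult_mult_right m_assoc q_nonzero

text \<open>The universal property of the presentation. Let each generator act on the torus by left
  multiplication with its prescribed image; these operators satisfy the torus relations, and \<phi>
  sends \<open>u\<close> to the result of applying \<open>u\<close> to the unit.\<close>

lemma endomorphism_exists:
  assumes cl: "a \<in> carrier L" "a' \<in> carrier L" "b \<in> carrier L" "b' \<in> carrier L"
    and inverses: "a \<otimes>\<^bsub>L\<^esub> a' = \<one>\<^bsub>L\<^esub>" "a' \<otimes>\<^bsub>L\<^esub> a = \<one>\<^bsub>L\<^esub>" "b \<otimes>\<^bsub>L\<^esub> b' = \<one>\<^bsub>L\<^esub>" "b' \<otimes>\<^bsub>L\<^esub> b = \<one>\<^bsub>L\<^esub>"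
    and commute: "a \<otimes>\<^bsub>L\<^esub> b = q \<odot>\<^bsub>L\<^esub> (b \<otimes>\<^bsub>L\<^esub> a)"
  obtains \<phi> where "algebra_endomorphism L \<phi>" "\<phi> x = a" "\<phi> xi = a'" "\<phi> y = b" "\<phi> yi = b'"
proof -
  let ?img = "\<lambda>g. case g of GX \<Rightarrow> a | GXi \<Rightarrow> a' | GY \<Rightarrow> b | GYi \<Rightarrow> b'"
  have img: "?img g \<in> carrier L" for g using cl by (cases g) auto
  interpret T: torus_operators L q "\<lambda>c u. c \<odot>\<^bsub>L\<^esub> u" "\<lambda>g u. ?img g \<otimes>\<^bsub>L\<^esub> u"
    using img
    by unfold_locales
       (simp_all add: smult_l_distr smult_r_distr smult_assoc r_distr smult_mult_right cl inverses commute
          smult_mult_left flip: m_assoc)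
  have word: "T.word_act w u = T.word_act w \<one>\<^bsub>L\<^esub> \<otimes>\<^bsub>L\<^esub> u" if "u \<in> carrier L" for w u
    by (induction w) (use that img in \<open>simp_all add: m_assoc\<close>)
  \<comment> \<open>The operator of \<open>r\<close> is left multiplication by its value at the
    unit. This turns composition of operators into a product in the torus and so makes \<phi>
    multiplicative.\<close>
  have right: "T.free_act r u = T.free_act r \<one>\<^bsub>L\<^esub> \<otimes>\<^bsub>L\<^esub> u" if "u \<in> carrier L" for r u
  proof (induction r rule: free_elem_induct)
    case (single w c)
    show ?case using that by (simp add: word[of u w] smult_mult_left)
  qed (use that in \<open>simp_all add: T.free_act_add_left l_distr\<close>)
  let ?\<phi> = "\<lambda>u. T.torus_act u \<one>\<^bsub>L\<^esub>"
  have cls: "?\<phi> (torus_class q r) = T.free_act r \<one>\<^bsub>L\<^esub>" for r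
    by (simp add: T.torus_act_class)
  have "?\<phi> \<in> ring_hom L L"
  proof (rule ring_hom_memI)
    fix u v assume "u \<in> carrier L" "v \<in> carrier L"
    then obtain r s where [simp]: "u = torus_class q r" "v = torus_class q s"
      by (auto simp only: torus_simps)
    show "?\<phi> u \<in> carrier L" by (simp add: cls)
    show "?\<phi> (u \<otimes>\<^bsub>L\<^esub> v) = ?\<phi> u \<otimes>\<^bsub>L\<^esub> ?\<phi> v"
      by (simp add: cls torus_simps(1) T.free_act_mult right[of "T.free_act s \<one>\<^bsub>L\<^esub>"])
    show "?\<phi> (u \<oplus>\<^bsub>L\<^esub> v) = ?\<phi> u \<oplus>\<^bsub>L\<^esub> ?\<phi> v"
      by (simp add: cls torus_simps(2) T.free_act_add_left)
  next
    show "?\<phi> \<one>\<^bsub>L\<^esub> = \<one>\<^bsub>L\<^esub>"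
      using cls[of 1] by (simp flip: torus_simps(4))
  qed
  moreover have "?\<phi> (c \<odot>\<^bsub>L\<^esub> u) = c \<odot>\<^bsub>L\<^esub> ?\<phi> u" if "u \<in> carrier L" for c u
  proof -
    obtain r where "u = torus_class q r" using \<open>u \<in> carrier L\<close> by (auto simp only: torus_simps)
    then show ?thesis by (simp add: cls torus_simps(3) T.free_act_mult)
  qed
  moreover have "?\<phi> (torus_class q (free_gen g)) = ?img g" for g
    using img by (simp add: cls free_gen_def)
  ultimately show ?thesis
    using that[of ?\<phi>] by (simp add: algebra_endomorphism_def)
qed

text \<open>Inverses are unique, so the values at \<open>x\<close> and \<open>y\<close> force those
  at \<open>xi\<close> and \<open>yi\<close>; induction over the torus does the rest.\<close>

lemma endomorphism_ext:
  assumes "algebra_endomorphism L \<phi>" "algebra_endomorphism L \<psi>" "\<phi> x = \<psi> x" "\<phi> y = \<psi> y"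
    and "u \<in> carrier L"
  shows "\<phi> u = \<psi> u"
proof -
  note hom = assms(1,2)[unfolded algebra_endomorphism_def]
  have cl: "\<phi> v \<in> carrier L" "\<psi> v \<in> carrier L" if "v \<in> carrier L" for v
    using hom that by (auto intro: ring_hom_closed)
  have mult: "\<phi> (v \<otimes>\<^bsub>L\<^esub> w) = \<phi> v \<otimes>\<^bsub>L\<^esub> \<phi> w" "\<psi> (v \<otimes>\<^bsub>L\<^esub> w) = \<psi> v \<otimes>\<^bsub>L\<^esub> \<psi> w"
    if "v \<in> carrier L" "w \<in> carrier L" for v w
    using hom that by (auto simp: ring_hom_mult)
  have one: "\<phi> \<one>\<^bsub>L\<^esub> = \<one>\<^bsub>L\<^esub>" "\<psi> \<one>\<^bsub>L\<^esub> = \<one>\<^bsub>L\<^esub>"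
    using hom by (auto simp: ring_hom_one)
  have inverse: "\<phi> ai = \<psi> ai"
    if "\<phi> a = \<psi> a" "a \<in> carrier L" "ai \<in> carrier L" "a \<otimes>\<^bsub>L\<^esub> ai = \<one>\<^bsub>L\<^esub>" "ai \<otimes>\<^bsub>L\<^esub> a = \<one>\<^bsub>L\<^esub>" for a ai
  proof (rule inv_unique)
    show "\<phi> ai \<otimes>\<^bsub>L\<^esub> \<phi> a = \<one>\<^bsub>L\<^esub>"
      using that one(1) mult(1)[of ai a] by simp
    show "\<phi> a \<otimes>\<^bsub>L\<^esub> \<psi> ai = \<one>\<^bsub>L\<^esub>"
      using that one(2) mult(2)[of a ai] by simp
  qed (use that cl in auto)
  from assms(5) show ?thesis
  proof (induction rule: torus_induct)
    case (gen g)
    show ?case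
      using assms(3,4) inverse[OF assms(3)] inverse[OF assms(4)] quantum_torus_relations[of q]
      by (cases g) auto
  next
    case (add u v)
    then show ?case using hom by (auto simp: ring_hom_add)
  qed (use hom in \<open>auto simp: one mult\<close>)
qed

text \<open>By \<open>endomorphism_ext\<close> a composite is the identity as soon as it fixes
  \<open>x\<close> and \<open>y\<close>.\<close>

lemma automorphism_of_inverse:
  assumes "algebra_endomorphism L \<phi>" "algebra_endomorphism L \<psi>"
    and "\<phi> (\<psi> x) = x" "\<phi> (\<psi> y) = y" "\<psi> (\<phi> x) = x" "\<psi> (\<phi> y) = y"
  shows "\<phi> \<in> algebra_automorphisms L"
proof -
  have id: "algebra_endomorphism L (\<lambda>u. u)"
    by (simp add: algebra_endomorphism_def ring_hom_def)
  have "\<phi> (\<psi> u) = u" "\<psi> (\<phi> u) = u" if "u \<in> carrier L" for u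
    using endomorphism_ext[OF algebra_endomorphism_comp[OF assms(1,2)] id _ _ that]
      endomorphism_ext[OF algebra_endomorphism_comp[OF assms(2,1)] id _ _ that] assms(3-) by auto
  moreover have "\<phi> u \<in> carrier L" "\<psi> u \<in> carrier L" if "u \<in> carrier L" for u
    using assms(1,2) that unfolding algebra_endomorphism_def ring_hom_def by auto
  ultimately have "bij_betw \<phi> (carrier L) (carrier L)"
    by (intro bij_betw_byWitness[where f' = \<psi>]) auto
  then show ?thesis
    using assms(1) by (simp add: algebra_automorphisms_def algebra_endomorphism_def ring_iso_def)
qed

lemma automorphism_scale:
  assumes "c \<noteq> 0"
  obtains \<tau> where "\<tau> \<in> algebra_automorphisms L" "\<tau> x = c \<odot>\<^bsub>L\<^esub> x" "\<tau> y = y"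
proof -
  obtain \<phi> where \<phi>: "algebra_endomorphism L \<phi>" "\<phi> x = c \<odot>\<^bsub>L\<^esub> x" "\<phi> y = y"
    using assms
    by (rule_tac endomorphism_exists[of "c \<odot>\<^bsub>L\<^esub> x" "inverse c \<odot>\<^bsub>L\<^esub> xi" y yi])
       (simp_all add: torus_normalise field_simps flip: smult_assoc)
  obtain \<psi> where \<psi>: "algebra_endomorphism L \<psi>" "\<psi> x = inverse c \<odot>\<^bsub>L\<^esub> x" "\<psi> y = y"
    using assms
    by (rule_tac endomorphism_exists[of "inverse c \<odot>\<^bsub>L\<^esub> x" "c \<odot>\<^bsub>L\<^esub> xi" y yi])
       (simp_all add: torus_normalise field_simps flip: smult_assoc)
  have "\<phi> \<in> algebra_automorphisms L"
    using assms \<phi>(1) \<psi>(1)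
    by (intro automorphism_of_inverse[OF \<phi>(1) \<psi>(1)])
       (simp_all add: \<phi> \<psi> algebra_endomorphism_def flip: smult_assoc)
  then show ?thesis using that \<phi> by blast
qed

text \<open>The pair (\<open>y\<close>, \<open>xi\<close>) satisfies the defining relation again, by
  \<open>normal_order\<close>. In the twisted module \<open>x\<close> acts as \<open>y\<close> did,
  which trades a power of \<open>y\<close> for a power of \<open>x\<close>.\<close>

lemma automorphism_rotation:
  obtains \<tau> where "\<tau> \<in> algebra_automorphisms L" "\<tau> x = y" "\<tau> y = xi"
proof -
  obtain \<phi> where \<phi>: "algebra_endomorphism L \<phi>" "\<phi> x = y" "\<phi> xi = yi" "\<phi> y = xi" "\<phi> yi = x"
    by (rule endomorphism_exists[of y yi xi x]) (simp_all add: torus_normalise)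
  obtain \<psi> where \<psi>: "algebra_endomorphism L \<psi>" "\<psi> x = yi" "\<psi> xi = y" "\<psi> y = x" "\<psi> yi = xi"
    by (rule endomorphism_exists[of yi y x xi]) (simp_all add: torus_normalise)
  have "\<phi> \<in> algebra_automorphisms L"
    by (rule automorphism_of_inverse[OF \<phi>(1) \<psi>(1)]) (simp_all add: \<phi> \<psi>)
  then show ?thesis using that \<phi> by blast
qed

text \<open>Up to scalars x^i y^j goes to x^(i+j) y^j. This is an elementary matrix on the
  exponents, and twisting by it undoes the addition: one subtraction of Euclid's algorithm.\<close>

lemma automorphism_shear_y:
  obtains \<tau> where "\<tau> \<in> algebra_automorphisms L" "\<tau> x = x" "\<tau> y = x \<otimes>\<^bsub>L\<^esub> y"
proof -
  obtain \<phi> where \<phi>: "algebra_endomorphism L \<phi>" "\<phi> x = x" "\<phi> xi = xi" "\<phi> y = x \<otimes>\<^bsub>L\<^esub> y"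
    by (rule endomorphism_exists[of x xi "x \<otimes>\<^bsub>L\<^esub> y" "yi \<otimes>\<^bsub>L\<^esub> xi"])
       (simp_all add: torus_normalise flip: smult_assoc)
  obtain \<psi> where \<psi>: "algebra_endomorphism L \<psi>" "\<psi> x = x" "\<psi> xi = xi" "\<psi> y = xi \<otimes>\<^bsub>L\<^esub> y"
    by (rule endomorphism_exists[of x xi "xi \<otimes>\<^bsub>L\<^esub> y" "yi \<otimes>\<^bsub>L\<^esub> x"])
       (simp_all add: torus_normalise flip: smult_assoc)
  have "\<phi> (u \<otimes>\<^bsub>L\<^esub> v) = \<phi> u \<otimes>\<^bsub>L\<^esub> \<phi> v" "\<psi> (u \<otimes>\<^bsub>L\<^esub> v) = \<psi> u \<otimes>\<^bsub>L\<^esub> \<psi> v"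
    if "u \<in> carrier L" "v \<in> carrier L" for u v
    using \<phi>(1) \<psi>(1) that by (auto simp: algebra_endomorphism_def ring_hom_mult)
  then have "\<phi> \<in> algebra_automorphisms L"
    by (intro automorphism_of_inverse[OF \<phi>(1) \<psi>(1)]) (simp_all add: \<phi> \<psi> torus_normalise)
  then show ?thesis using that \<phi> by blast
qed

text \<open>The other elementary matrix: up to scalars x^i y^j goes to x^i y^(i+j).\<close>

lemma automorphism_shear_x:
  obtains \<tau> where "\<tau> \<in> algebra_automorphisms L" "\<tau> x = x \<otimes>\<^bsub>L\<^esub> y" "\<tau> y = y"
proof -
  obtain \<phi> where \<phi>: "algebra_endomorphism L \<phi>" "\<phi> x = x \<otimes>\<^bsub>L\<^esub> y" "\<phi> y = y" "\<phi> yi = yi"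
    by (rule endomorphism_exists[of "x \<otimes>\<^bsub>L\<^esub> y" "yi \<otimes>\<^bsub>L\<^esub> xi" y yi])
       (simp_all add: torus_normalise flip: smult_assoc)
  obtain \<psi> where \<psi>: "algebra_endomorphism L \<psi>" "\<psi> x = x \<otimes>\<^bsub>L\<^esub> yi" "\<psi> y = y" "\<psi> yi = yi"
    by (rule endomorphism_exists[of "x \<otimes>\<^bsub>L\<^esub> yi" "y \<otimes>\<^bsub>L\<^esub> xi" y yi])
       (simp_all add: torus_normalise flip: smult_assoc)
  have "\<phi> (u \<otimes>\<^bsub>L\<^esub> v) = \<phi> u \<otimes>\<^bsub>L\<^esub> \<phi> v" "\<psi> (u \<otimes>\<^bsub>L\<^esub> v) = \<psi> u \<otimes>\<^bsub>L\<^esub> \<psi> v"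
    if "u \<in> carrier L" "v \<in> carrier L" for u v
    using \<phi>(1) \<psi>(1) that by (auto simp: algebra_endomorphism_def ring_hom_mult)
  then have "\<phi> \<in> algebra_automorphisms L"
    by (intro automorphism_of_inverse[OF \<phi>(1) \<psi>(1)]) (simp_all add: \<phi> \<psi> torus_normalise)
  then show ?thesis using that \<phi> by blast
qed

end

section \<open>Twisted modules\<close>

lemma twist_simps [simp]:
  "carrier (twist \<tau> M) = carrier M" "add (twist \<tau> M) = add M" "ring.zero (twist \<tau> M) = ring.zero M"
  "u \<odot>\<^bsub>twist \<tau> M\<^esub> v = \<tau> u \<odot>\<^bsub>M\<^esub> v"
  by (simp_all add: twist_def)

lemma left_module_twist:
  assumes "left_module A M" "\<tau> \<in> ring_hom A A"
  shows "left_module A (twist \<tau> M)"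
proof -
  interpret left_module A M by fact
  have "abelian_group (twist \<tau> M)"
    using M.add.l_inv_ex by (intro abelian_groupI) (auto simp: M.a_ac)
  moreover have "left_module_axioms A (twist \<tau> M)"
    using assms(2)
    by (intro left_module_axioms.intro)
       (simp_all add: ring_hom_closed ring_hom_add ring_hom_mult ring_hom_one
          act_l_distr act_r_distr act_assoc)
  ultimately show ?thesis
    using R.ring_axioms by (intro left_module.intro)
qed

text \<open>As \<tau> is onto, the action of \<open>a\<close> on \<open>M\<close> is the twisted
  action of some \<open>b\<close>. Hence a submodule of the twist is already a submodule of
  \<open>M\<close>.\<close>

lemma simple_module_twist:
  assumes "simple_module A M" "\<tau> \<in> algebra_automorphisms A"
  shows "simple_module A (twist \<tau> M)"
proof -
  have hom: "\<tau> \<in> ring_hom A A" and bij: "bij_betw \<tau> (carrier A) (carrier A)"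
    using assms(2) by (auto simp: algebra_automorphisms_def ring_iso_def)
  have "submodule N A M" if "submodule N A (twist \<tau> M)" for N
  proof (intro submodule.intro submodule_axioms.intro)
    have "add_monoid (twist \<tau> M) = add_monoid M" by simp
    then show "subgroup N (add_monoid M)"
      using that by (metis submodule.axioms(1))
    fix a v assume "a \<in> carrier A" "v \<in> N"
    moreover obtain b where "b \<in> carrier A" "a = \<tau> b"
      using bij \<open>a \<in> carrier A\<close> by (auto simp: bij_betw_def)
    ultimately show "a \<odot>\<^bsub>M\<^esub> v \<in> N"
      using submodule.smult_closed[OF that, of b v] by simp
  qed
  then show ?thesis
    using assms(1) left_module_twist[OF _ hom] by (auto simp: simple_module_def)
qed

text \<open>Replacing \<open>a\<close> by its preimage under \<epsilon> in the intertwining identity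
  moves the twist from \<open>M\<close> to \<open>V\<close>. The map \<open>h\<close> stays the
  same.\<close>

lemma module_isomorphic_untwist:
  assumes "complex_algebra A" "\<epsilon> \<in> algebra_automorphisms A"
    and "module_isomorphic A (twist \<tau> V) (twist \<epsilon> M)"
  shows "module_isomorphic A (twist (\<tau> \<circ> inv_into (carrier A) \<epsilon>) V) M"
proof -
  have bij: "bij_betw \<epsilon> (carrier A) (carrier A)"
    using assms(2) by (auto simp: algebra_automorphisms_def ring_iso_def)
  obtain h where h: "bij_betw h (carrier V) (carrier M)"
      "\<And>v w. v \<in> carrier V \<Longrightarrow> w \<in> carrier V \<Longrightarrow> h (v \<oplus>\<^bsub>V\<^esub> w) = h v \<oplus>\<^bsub>M\<^esub> h w"
      "\<And>a v. a \<in> carrier A \<Longrightarrow> v \<in> carrier V \<Longrightarrow> h (\<tau> a \<odot>\<^bsub>V\<^esub> v) = \<epsilon> a \<odot>\<^bsub>M\<^esub> h v"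
    using assms(3) by (auto simp: module_isomorphic_def)
  have "h (\<tau> (inv_into (carrier A) \<epsilon> a) \<odot>\<^bsub>V\<^esub> v) = a \<odot>\<^bsub>M\<^esub> h v"
    if "a \<in> carrier A" "v \<in> carrier V" for a v
    using h(3)[of "inv_into (carrier A) \<epsilon> a" v] that bij
    by (auto simp: bij_betw_def inv_into_into f_inv_into_f)
  then show ?thesis
    using h(1,2) by (auto simp: module_isomorphic_def)
qed

section \<open>Modules over the quantum torus\<close>

text \<open>The value of \<open>p\<close> at \<open>r\<close>. It is taken in the free algebra,
  where the arithmetic of type classes is at hand, and is carried to the torus by
  \<open>torus_class\<close>; scalars sit on the empty word.\<close>

definition free_peval :: "'g free_elem \<Rightarrow> complex poly \<Rightarrow> 'g free_elem" where
  "free_peval r p = (\<Sum>i\<le>degree p. Poly_Mapping.single [] (coeff p i) * r ^ i)"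

lemma free_peval_superset:
  assumes "degree p \<le> N"
  shows "free_peval r p = (\<Sum>i\<le>N. Poly_Mapping.single [] (coeff p i) * r ^ i)"
  unfolding free_peval_def using assms
  by (intro sum.mono_neutral_left) (auto simp: coeff_eq_0)

text \<open>The new coefficients are the old ones shifted by one, minus \<open>z\<close> times the
  old ones. The shift becomes a factor \<open>r\<close> on the left because scalars are central. The
  common bound \<open>Suc (degree p)\<close> also covers p = 0.\<close>

lemma free_peval_linear_factor:
  "free_peval r ([:- z, 1:] * p) = (r - Poly_Mapping.single [] z) * free_peval r p"
proof -
  have deg: "degree ([:- z, 1:] * p) \<le> Suc (degree p)"
    using degree_mult_le[of "[:- z, 1:]" p] by simp
  have "free_peval r ([:- z, 1:] * p) =
      (\<Sum>i\<le>Suc (degree p). Poly_Mapping.single [] (coeff (pCons 0 p) i) * r ^ i) -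
      (\<Sum>i\<le>Suc (degree p). Poly_Mapping.single [] (z * coeff p i) * r ^ i)"
    unfolding free_peval_superset[OF deg]
    by (simp add: single_diff left_diff_distrib flip: sum_subtractf)
  also have "(\<Sum>i\<le>Suc (degree p). Poly_Mapping.single [] (coeff (pCons 0 p) i) * r ^ i) = r * free_peval r p"
    by (simp add: sum.atMost_Suc_shift free_peval_def sum_distrib_left single_Nil_commute mult.assoc del: sum.atMost_Suc)
  also have "(\<Sum>i\<le>Suc (degree p). Poly_Mapping.single [] (z * coeff p i) * r ^ i) =
      Poly_Mapping.single [] z * (\<Sum>i\<le>Suc (degree p). Poly_Mapping.single [] (coeff p i) * r ^ i)"
    unfolding sum_distrib_left by (simp add: mult_single plus_list_def flip: mult.assoc)
  also have "(\<Sum>i\<le>Suc (degree p). Poly_Mapping.single [] (coeff p i) * r ^ i) = free_peval r p"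
    by (subst free_peval_superset[of p "Suc (degree p)"]) (simp_all add: coeff_eq_0)
  finally show ?thesis by (simp add: left_diff_distrib)
qed

locale torus_module = torus_algebra q + left_module "quantum_torus q" M
  for q and M :: "(torus_elem, 'v) module"
begin

abbreviation scale :: "complex \<Rightarrow> 'v \<Rightarrow> 'v" where
  "scale c v \<equiv> (c \<odot>\<^bsub>L\<^esub> \<one>\<^bsub>L\<^esub>) \<odot>\<^bsub>M\<^esub> v"

lemma act_zero [simp]: "a \<in> carrier L \<Longrightarrow> a \<odot>\<^bsub>M\<^esub> \<zero>\<^bsub>M\<^esub> = \<zero>\<^bsub>M\<^esub>"
  using act_r_distr[of a "\<zero>\<^bsub>M\<^esub>" "\<zero>\<^bsub>M\<^esub>"] M.add.r_cancel_one[of "a \<odot>\<^bsub>M\<^esub> \<zero>\<^bsub>M\<^esub>" "a \<odot>\<^bsub>M\<^esub> \<zero>\<^bsub>M\<^esub>"] by simp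

lemma smult_act:
  assumes "a \<in> carrier L" "v \<in> carrier M"
  shows "(c \<odot>\<^bsub>L\<^esub> a) \<odot>\<^bsub>M\<^esub> v = scale c (a \<odot>\<^bsub>M\<^esub> v)"
  using assms by (simp add: smult_mult_left flip: act_assoc)

lemma act_scale:
  assumes "a \<in> carrier L" "v \<in> carrier M"
  shows "a \<odot>\<^bsub>M\<^esub> scale c v = scale c (a \<odot>\<^bsub>M\<^esub> v)"
  using assms by (simp add: smult_mult_left smult_mult_right flip: act_assoc)

lemma scale_scale [simp]: "v \<in> carrier M \<Longrightarrow> scale c (scale d v) = scale (c * d) v"
  by (simp add: smult_mult_left smult_mult_right mult.commute flip: smult_assoc act_assoc)

lemma scale_eq_zero:
  assumes "v \<in> carrier M" "scale c v = \<zero>\<^bsub>M\<^esub>" "c \<noteq> 0"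
  shows "v = \<zero>\<^bsub>M\<^esub>"
  using scale_scale[of v "inverse c" c] assms by simp

lemma scale_zero [simp]:
  assumes "v \<in> carrier M"
  shows "scale 0 v = \<zero>\<^bsub>M\<^esub>"
proof -
  have "scale (0 + 0) v = scale 0 v \<oplus>\<^bsub>M\<^esub> scale 0 v"
    using assms by (simp only: smult_l_distr act_l_distr one_closed smult_closed)
  then show ?thesis
    using assms M.add.r_cancel_one[of "scale 0 v" "scale 0 v"] by simp
qed

lemma scale_minus_one:
  assumes "v \<in> carrier M"
  shows "scale (- 1) v = \<ominus>\<^bsub>M\<^esub> v"
proof (rule M.minus_equality[symmetric])
  have "scale (- 1 + 1) v = scale (- 1) v \<oplus>\<^bsub>M\<^esub> scale 1 v"
    using assms by (simp only: smult_l_distr act_l_distr one_closed smult_closed)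
  then show "scale (- 1) v \<oplus>\<^bsub>M\<^esub> v = \<zero>\<^bsub>M\<^esub>" using assms by simp
qed (use assms in auto)

lemma torus_class_scalar: "torus_class q (Poly_Mapping.single [] c) = c \<odot>\<^bsub>L\<^esub> \<one>\<^bsub>L\<^esub>"
  by (simp add: torus_simps)

text \<open>Split off a root: p = (X - z) p'. If p'(r) does not kill \<open>w\<close>, then p'(r) w
  is an eigenvector for \<open>z\<close>; otherwise p' is an annihilating polynomial of smaller
  degree. Degree 0 cannot occur, since a nonzero constant does not kill \<open>w\<close>.\<close>

lemma eigenvector_of_annihilating_poly:
  assumes "p \<noteq> 0" "w \<in> carrier M" "w \<noteq> \<zero>\<^bsub>M\<^esub>" "torus_class q (free_peval r p) \<odot>\<^bsub>M\<^esub> w = \<zero>\<^bsub>M\<^esub>"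
  shows "\<exists>v \<in> carrier M. v \<noteq> \<zero>\<^bsub>M\<^esub> \<and> (\<exists>z. torus_class q r \<odot>\<^bsub>M\<^esub> v = scale z v)"
  using assms(1,4)
proof (induction "degree p" arbitrary: p)
  case 0
  then obtain a where a: "p = [:a:]" by (auto elim: degree_eq_zeroE)
  then have "scale a w = \<zero>\<^bsub>M\<^esub>"
    using 0 by (simp add: free_peval_def torus_class_scalar)
  then show ?case using scale_eq_zero[OF assms(2)] a 0(2) assms(3) by auto
next
  case (Suc d)
  then have "\<not> constant (poly p)" by (simp add: constant_degree)
  then obtain z where "poly p z = 0" using fundamental_theorem_of_algebra by blast
  then obtain p' where p: "p = [:- z, 1:] * p'" by (auto simp: poly_eq_0_iff_dvd)
  have p': "p' \<noteq> 0" using p Suc.prems by auto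
  have d: "d = degree p'"
    using Suc.hyps(2) p' unfolding p by (subst (asm) degree_mult_eq) auto
  let ?v = "torus_class q (free_peval r p') \<odot>\<^bsub>M\<^esub> w"
  have v: "?v \<in> carrier M" using assms(2) by simp
  have zero: "torus_class q (r - Poly_Mapping.single [] z) \<odot>\<^bsub>M\<^esub> ?v = \<zero>\<^bsub>M\<^esub>"
    using Suc.prems(2) assms(2) unfolding p free_peval_linear_factor
    by (simp flip: torus_simps(1) act_assoc)
  show ?case
  proof (cases "?v = \<zero>\<^bsub>M\<^esub>")
    case True
    then show ?thesis using Suc.hyps(1)[OF d p'] by simp
  next
    case False
    have "torus_class q r =
        torus_class q (r - Poly_Mapping.single [] z) \<oplus>\<^bsub>L\<^esub> torus_class q (Poly_Mapping.single [] z)"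
      by (simp add: torus_simps)
    then have "torus_class q r \<odot>\<^bsub>M\<^esub> ?v = scale z ?v"
      using zero v by (simp add: act_l_distr torus_class_scalar)
    with False v show ?thesis by blast
  qed
qed

end

section \<open>Modules generated by an eigenvector of \<open>x\<close>\<close>

definition y_word :: "int \<Rightarrow> torus_gen list" where
  "y_word k = (if 0 \<le> k then replicate (nat k) GY else replicate (nat (- k)) GYi)"

text \<open>A representative of \<open>f(y)\<close>.\<close>

definition laurent_lift :: "laurent \<Rightarrow> torus_gen free_elem" where
  "laurent_lift f = (\<Sum>k \<in> Poly_Mapping.keys f. Poly_Mapping.single (y_word k) (Poly_Mapping.lookup f k))"

lemma laurent_lift_superset:
  assumes "finite K" "Poly_Mapping.keys f \<subseteq> K"
  shows "laurent_lift f = (\<Sum>k \<in> K. Poly_Mapping.single (y_word k) (Poly_Mapping.lookup f k))"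
  unfolding laurent_lift_def using assms
  by (intro sum.mono_neutral_left) (auto simp: in_keys_iff)

lemma laurent_lift_add: "laurent_lift (f + g) = laurent_lift f + laurent_lift g"
proof -
  let ?K = "Poly_Mapping.keys f \<union> Poly_Mapping.keys g"
  have "Poly_Mapping.keys (f + g) \<subseteq> ?K" by (rule Poly_Mapping.keys_add)
  then show ?thesis
    by (simp add: laurent_lift_superset[of ?K] lookup_add single_add sum.distrib)
qed

lemma laurent_lift_single [simp]:
  "laurent_lift (Poly_Mapping.single k c) = Poly_Mapping.single (y_word k) c"
  by (simp add: laurent_lift_superset[of "{k}"])

lemma laurent_induct [case_names single add]:
  fixes f :: laurent
  assumes "\<And>k c. P (Poly_Mapping.single k c)" "\<And>f g. P f \<Longrightarrow> P g \<Longrightarrow> P (f + g)"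
  shows "P f"
proof (induction f rule: Poly_Mapping.update_induct)
  case const
  then show ?case using assms(1)[of 0 0] by simp
next
  case (update f a b)
  have "Poly_Mapping.update a b f = f + Poly_Mapping.single a b"
    using update.hyps
    by (intro poly_mapping_eqI)
       (auto simp: lookup_update lookup_add lookup_single when_def in_keys_iff)
  then show ?case using update.IH assms by simp
qed

context torus_algebra
begin

abbreviation y_power :: "int \<Rightarrow> torus_elem" where
  "y_power k \<equiv> torus_class q (Poly_Mapping.single (y_word k) 1)"

lemma y_power_0 [simp]: "y_power 0 = \<one>\<^bsub>L\<^esub>"
  by (simp add: y_word_def torus_simps one_free)

lemma y_power_succ: "y_power (k + 1) = y \<otimes>\<^bsub>L\<^esub> y_power k"
proof (cases "0 \<le> k")
  case True
  then have "y_word (k + 1) = GY # y_word k" by (simp add: y_word_def nat_add_distrib)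
  then show ?thesis by (simp add: torus_word_Cons)
next
  case False
  then have "nat (- k) = Suc (nat (- (k + 1)))" by simp
  then have "y_word k = GYi # y_word (k + 1)"
    using False by (auto simp: y_word_def)
  then have "y_power k = yi \<otimes>\<^bsub>L\<^esub> y_power (k + 1)" by (simp only: torus_word_Cons)
  then show ?thesis by (simp add: torus_normalise)
qed

text \<open>Applied to an eigenvector of \<open>x\<close>, \<open>y_power k\<close> therefore yields
  vectors whose eigenvalue is multiplied by \<open>q powi k\<close>.\<close>

lemma x_y_power: "x \<otimes>\<^bsub>L\<^esub> y_power k = q powi k \<odot>\<^bsub>L\<^esub> (y_power k \<otimes>\<^bsub>L\<^esub> x)"
proof (induction k rule: int_induct[of _ 0])
  case base
  show ?case by simp
next
  case (step1 k)
  have "x \<otimes>\<^bsub>L\<^esub> y_power (k + 1) = q \<odot>\<^bsub>L\<^esub> (y \<otimes>\<^bsub>L\<^esub> (x \<otimes>\<^bsub>L\<^esub> y_power k))"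
    by (simp add: y_power_succ prefix[OF quantum_torus_relations(5)])
  also have "\<dots> = q powi (k + 1) \<odot>\<^bsub>L\<^esub> (y_power (k + 1) \<otimes>\<^bsub>L\<^esub> x)"
    by (simp add: step1 y_power_succ smult_mult_right m_assoc q_nonzero power_int_add mult.commute
        flip: smult_assoc)
  finally show ?case .
next
  case (step2 k)
  have eq: "y_power (k - 1) = yi \<otimes>\<^bsub>L\<^esub> y_power k"
    using y_power_succ[of "k - 1"] by (simp add: torus_normalise)
  have "x \<otimes>\<^bsub>L\<^esub> yi = inverse q \<odot>\<^bsub>L\<^esub> (yi \<otimes>\<^bsub>L\<^esub> x)"
    by (simp add: normal_order q_nonzero flip: smult_assoc)
  then have "x \<otimes>\<^bsub>L\<^esub> y_power (k - 1) = inverse q \<odot>\<^bsub>L\<^esub> (yi \<otimes>\<^bsub>L\<^esub> (x \<otimes>\<^bsub>L\<^esub> y_power k))"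
    by (simp add: eq prefix)
  also have "\<dots> = q powi (k - 1) \<odot>\<^bsub>L\<^esub> (y_power (k - 1) \<otimes>\<^bsub>L\<^esub> x)"
    by (simp add: step2 eq smult_mult_right m_assoc q_nonzero power_int_diff divide_inverse mult.commute
        flip: smult_assoc)
  finally show ?case .
qed

end

text \<open>\<open>generic\<close> speaks of positive exponents only, so the two exponents are
  ordered first and their difference is used.\<close>

lemma generic_powi_inj:
  assumes "generic q" "q \<noteq> 0" "q powi j = q powi k"
  shows "j = k"
proof (rule ccontr)
  assume "j \<noteq> k"
  have *: False if "j < k" "q powi j = q powi k" for j k :: int
  proof -
    have "q powi (k - j) = 1"
      using that assms(2) by (simp add: power_int_diff)
    then have "q ^ nat (k - j) = 1"
      using that by (simp add: power_int_def split: if_splits)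
    then show False using assms(1) that by (simp add: generic_def)
  qed
  show False using *[of j k] *[of k j] \<open>j \<noteq> k\<close> assms(3) by (cases "j < k") auto
qed

lemma basic_module_simps [simp]:
  "carrier (basic_module q) = UNIV" "add (basic_module q) = (+)" "ring.zero (basic_module q) = 0"
  by (simp_all add: basic_module_def)

context torus_module
begin

lemma isomorphic_of_x_eigenvector:
  assumes simple: "simple_module L M" and generic: "generic q"
    and w: "w \<in> carrier M" "w \<noteq> \<zero>\<^bsub>M\<^esub>" "x \<odot>\<^bsub>M\<^esub> w = scale \<mu> w"
  shows "\<exists>\<tau> \<in> algebra_automorphisms L. module_isomorphic L (twist \<tau> (basic_module q)) M"
proof -
  let ?V = "basic_module q"
  interpret V: left_module L ?V by (rule left_module_basic[OF q_nonzero])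
  \<comment> \<open>\<open>x\<close> is invertible, so eigenvalue 0 would force \<open>w\<close> to
    vanish.\<close>
  have "\<mu> \<noteq> 0"
  proof
    assume "\<mu> = 0"
    then have "xi \<odot>\<^bsub>M\<^esub> (x \<odot>\<^bsub>M\<^esub> w) = \<zero>\<^bsub>M\<^esub>"
      using w by simp
    then show False
      using w act_assoc[of xi x w] by (simp add: quantum_torus_relations(2) del: act_assoc)
  qed
  \<comment> \<open>On the basic module t^k has \<open>x\<close>-eigenvalue q^k, while y^k w has
    eigenvalue \<mu> q^k. Rescaling \<open>x\<close> by \<mu> makes them agree.\<close>
  obtain \<tau> where \<tau>: "\<tau> \<in> algebra_automorphisms L" "\<tau> x = \<mu> \<odot>\<^bsub>L\<^esub> x" "\<tau> y = y"
    using automorphism_scale[OF \<open>\<mu> \<noteq> 0\<close>] by blast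
  have hom: "\<tau> \<in> ring_hom L L" and lin: "\<And>c a. a \<in> carrier L \<Longrightarrow> \<tau> (c \<odot>\<^bsub>L\<^esub> a) = c \<odot>\<^bsub>L\<^esub> \<tau> a"
    using \<tau>(1) by (auto simp: algebra_automorphisms_def ring_iso_def)
  have \<tau>_cl: "\<tau> a \<in> carrier L" if "a \<in> carrier L" for a
    using hom that by (rule ring_hom_closed)
  \<comment> \<open>The candidate isomorphism sends f(t) to f(y) w.\<close>
  define h where "h f = torus_class q (laurent_lift f) \<odot>\<^bsub>M\<^esub> w" for f
  have h_cl [simp]: "h f \<in> carrier M" for f using w by (simp add: h_def)
  have h_add: "h (f + g) = h f \<oplus>\<^bsub>M\<^esub> h g" for f g
    using w by (simp add: h_def laurent_lift_add act_l_distr flip: torus_simps(2))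
  have h_single: "h (Poly_Mapping.single k c) = scale c (y_power k \<odot>\<^bsub>M\<^esub> w)" for k c
  proof -
    have "torus_class q (Poly_Mapping.single (y_word k) c) = c \<odot>\<^bsub>L\<^esub> y_power k"
      by (simp add: torus_simps(3) mult_single plus_list_def)
    then show ?thesis using w by (simp add: h_def smult_act[of "y_power k"])
  qed
  have h_scale: "h (Poly_Mapping.single 0 c * f) = scale c (h f)" for c f
  proof (induction f rule: laurent_induct)
    case (single k d)
    show ?case using w by (simp add: mult_single h_single)
  next
    case (add f g)
    then show ?case by (simp add: distrib_left h_add act_r_distr)
  qed
  have h_y: "h (Poly_Mapping.single 1 1 * f) = y \<odot>\<^bsub>M\<^esub> h f" for f
  proof (induction f rule: laurent_induct)
    case (single k d)
    show ?case
      using w by (simp add: mult_single h_single act_scale[of y] add.commute[of 1 k] y_power_succ act_assoc)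
  next
    case (add f g)
    then show ?case by (simp add: distrib_left h_add act_r_distr)
  qed
  have dilate_add: "laurent_dilate q (f + g) = laurent_dilate q f + laurent_dilate q g" for f g
    by (intro poly_mapping_eqI) (simp add: laurent_lookup_dilate lookup_add distrib_left)
  have dilate_single: "laurent_dilate q (Poly_Mapping.single k c) = Poly_Mapping.single k (q powi k * c)" for k c
    by (intro poly_mapping_eqI) (auto simp: laurent_lookup_dilate lookup_single when_def)
  have x_y_w: "x \<odot>\<^bsub>M\<^esub> (y_power k \<odot>\<^bsub>M\<^esub> w) = scale (\<mu> * q powi k) (y_power k \<odot>\<^bsub>M\<^esub> w)" for k
  proof -
    have "x \<odot>\<^bsub>M\<^esub> (y_power k \<odot>\<^bsub>M\<^esub> w) = (q powi k \<odot>\<^bsub>L\<^esub> (y_power k \<otimes>\<^bsub>L\<^esub> x)) \<odot>\<^bsub>M\<^esub> w"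
      using w by (simp add: x_y_power flip: act_assoc)
    also have "\<dots> = scale (q powi k) (y_power k \<odot>\<^bsub>M\<^esub> (x \<odot>\<^bsub>M\<^esub> w))"
      using w by (simp add: smult_act[of "y_power k \<otimes>\<^bsub>L\<^esub> x"] act_assoc)
    finally show ?thesis using w by (simp add: act_scale[of "y_power k" w] mult.commute)
  qed
  have h_x: "x \<odot>\<^bsub>M\<^esub> h f = scale \<mu> (h (laurent_dilate q f))" for f
  proof (induction f rule: laurent_induct)
    case (single k d)
    show ?case
      using w by (simp add: dilate_single h_single act_scale[of x] x_y_w mult_ac)
  next
    case (add f g)
    then show ?case by (simp add: dilate_add h_add act_r_distr)
  qed
  have x_V: "x \<odot>\<^bsub>?V\<^esub> f = laurent_dilate q f" for f
    by (intro poly_mapping_eqI) (simp add: basic_module_action[OF q_nonzero] laurent_lookup_dilate)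
  have V_scale: "(c \<odot>\<^bsub>L\<^esub> a) \<odot>\<^bsub>?V\<^esub> f = Poly_Mapping.single 0 c * (a \<odot>\<^bsub>?V\<^esub> f)" if "a \<in> carrier L" for c a f
  proof -
    have "(c \<odot>\<^bsub>L\<^esub> a) \<odot>\<^bsub>?V\<^esub> f = (c \<odot>\<^bsub>L\<^esub> \<one>\<^bsub>L\<^esub>) \<odot>\<^bsub>?V\<^esub> (a \<odot>\<^bsub>?V\<^esub> f)"
      using that V.act_assoc[of "c \<odot>\<^bsub>L\<^esub> \<one>\<^bsub>L\<^esub>" a f] by (simp add: smult_mult_left)
    then show ?thesis by (simp only: basic_module_action(3)[OF q_nonzero])
  qed
  \<comment> \<open>If \<open>h\<close> intertwines an invertible element, it intertwines the
    inverse as well. Among the generators only \<open>x\<close> and \<open>y\<close> are then left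
    to compute.\<close>
  have inverse: "h (\<tau> b \<odot>\<^bsub>?V\<^esub> f) = b \<odot>\<^bsub>M\<^esub> h f"
    if "\<And>f. h (\<tau> a \<odot>\<^bsub>?V\<^esub> f) = a \<odot>\<^bsub>M\<^esub> h f" "a \<in> carrier L" "b \<in> carrier L"
      "a \<otimes>\<^bsub>L\<^esub> b = \<one>\<^bsub>L\<^esub>" "b \<otimes>\<^bsub>L\<^esub> a = \<one>\<^bsub>L\<^esub>" for a b f
  proof -
    have "\<tau> a \<otimes>\<^bsub>L\<^esub> \<tau> b = \<one>\<^bsub>L\<^esub>"
      using ring_hom_mult[OF hom that(2,3)] ring_hom_one[OF hom] that(4) by simp
    then have "\<tau> a \<odot>\<^bsub>?V\<^esub> (\<tau> b \<odot>\<^bsub>?V\<^esub> f) = f"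
      using V.act_assoc[of "\<tau> a" "\<tau> b" f] V.act_one[of f] \<tau>_cl that by simp
    then have "h f = a \<odot>\<^bsub>M\<^esub> h (\<tau> b \<odot>\<^bsub>?V\<^esub> f)" using that(1)[of "\<tau> b \<odot>\<^bsub>?V\<^esub> f"] by simp
    then show ?thesis using that by (simp flip: act_assoc)
  qed
  have intertwine: "h (\<tau> a \<odot>\<^bsub>?V\<^esub> f) = a \<odot>\<^bsub>M\<^esub> h f" if "a \<in> carrier L" for a f
    using that
  proof (induction arbitrary: f rule: torus_induct)
    case (gen g)
    have 1: "h (\<tau> x \<odot>\<^bsub>?V\<^esub> f) = x \<odot>\<^bsub>M\<^esub> h f" for f
      by (simp add: \<tau>(2) V_scale x_V h_scale h_x)
    have 2: "h (\<tau> y \<odot>\<^bsub>?V\<^esub> f) = y \<odot>\<^bsub>M\<^esub> h f" for f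
      by (simp add: \<tau>(3) basic_module_action[OF q_nonzero] h_y)
    show ?case
      using 1 2 inverse[OF 1 _ _ quantum_torus_relations(1,2)]
        inverse[OF 2 _ _ quantum_torus_relations(3,4)] by (cases g) auto
  next
    case one
    show ?case using V.act_one[of f] by (simp add: ring_hom_one[OF hom])
  next
    case (scale c u)
    then show ?case by (simp add: lin V_scale \<tau>_cl h_scale smult_act[of u])
  next
    case (add u v)
    then show ?case
      using V.act_l_distr[of "\<tau> u" "\<tau> v" f] \<tau>_cl by (simp add: ring_hom_add[OF hom] h_add act_l_distr)
  next
    case (mult u v)
    then show ?case
      using V.act_assoc[of "\<tau> u" "\<tau> v" f] \<tau>_cl by (simp add: ring_hom_mult[OF hom] act_assoc)
  qed
  have y_w: "y_power k \<odot>\<^bsub>M\<^esub> w \<noteq> \<zero>\<^bsub>M\<^esub>" for k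
  proof (induction k rule: int_induct[of _ 0])
    case base
    show ?case using w by simp
  next
    case (step1 k)
    have "yi \<odot>\<^bsub>M\<^esub> (y_power (k + 1) \<odot>\<^bsub>M\<^esub> w) = y_power k \<odot>\<^bsub>M\<^esub> w"
      using w by (simp add: y_power_succ torus_normalise flip: act_assoc)
    with step1 show ?case by auto
  next
    case (step2 k)
    have "y \<odot>\<^bsub>M\<^esub> (y_power (k - 1) \<odot>\<^bsub>M\<^esub> w) = y_power k \<odot>\<^bsub>M\<^esub> w"
      using w y_power_succ[of "k - 1"] by (simp flip: act_assoc)
    with step2 show ?case by auto
  qed
  \<comment> \<open>Subtracting \<open>q\<^sup>k f(t)\<close> from \<open>f(q t)\<close> removes the exponent \<open>k\<close> from \<open>f\<close>.\<close>
  have kernel: "f = 0" if "h f = \<zero>\<^bsub>M\<^esub>" for f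
    using that
  proof (induction "card (Poly_Mapping.keys f)" arbitrary: f rule: less_induct)
    case less
    show ?case
    proof (rule ccontr)
      assume "f \<noteq> 0"
      then obtain k where k: "k \<in> Poly_Mapping.keys f" by fastforce
      define g where "g = laurent_dilate q f + Poly_Mapping.single 0 (- (q powi k)) * f"
      have g: "Poly_Mapping.lookup g j = (q powi j - q powi k) * Poly_Mapping.lookup f j" for j
        by (simp add: g_def lookup_add laurent_lookup_dilate laurent_lookup_monomial left_diff_distrib)
      have "scale \<mu> (h (laurent_dilate q f)) = \<zero>\<^bsub>M\<^esub>"
        using h_x[of f] less.prems by simp
      then have "h (laurent_dilate q f) = \<zero>\<^bsub>M\<^esub>"
        using scale_eq_zero \<open>\<mu> \<noteq> 0\<close> by simp
      then have "h g = \<zero>\<^bsub>M\<^esub>"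
        by (simp add: g_def h_add h_scale less.prems)
      moreover have "Poly_Mapping.keys g \<subset> Poly_Mapping.keys f"
        using k by (auto simp: in_keys_iff g)
      then have "card (Poly_Mapping.keys g) < card (Poly_Mapping.keys f)"
        by (intro psubset_card_mono) auto
      ultimately have "g = 0" using less.hyps by blast
      \<comment> \<open>Since g = 0 and q^j differs from q^k for all other j, only the exponent
        \<open>k\<close> survives in \<open>f\<close>. Then \<open>h f\<close> is a nonzero multiple
        of y^k w, which is not zero.\<close>
      then have "Poly_Mapping.lookup f j = 0" if "j \<noteq> k" for j
        using g[of j] generic_powi_inj[OF generic q_nonzero, of j k] that by auto
      then have "f = Poly_Mapping.single k (Poly_Mapping.lookup f k)"
        by (intro poly_mapping_eqI) (auto simp: lookup_single when_def)
      then have "scale (Poly_Mapping.lookup f k) (y_power k \<odot>\<^bsub>M\<^esub> w) = \<zero>\<^bsub>M\<^esub>"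
        using less.prems h_single[of k "Poly_Mapping.lookup f k"] by simp
      then show False
        using scale_eq_zero[of "y_power k \<odot>\<^bsub>M\<^esub> w"] y_w k w(1) by (simp add: in_keys_iff)
    qed
  qed
  have "inj h"
  proof (rule injI)
    fix f g assume "h f = h g"
    then have "h (f + Poly_Mapping.single 0 (- 1) * g) = \<zero>\<^bsub>M\<^esub>"
      by (simp add: h_add h_scale scale_minus_one M.r_neg)
    then have "f + Poly_Mapping.single 0 (- 1) * g = 0" by (rule kernel)
    then show "f = g"
      by (intro poly_mapping_eqI)
        (metis add_uminus_conv_diff eq_iff_diff_eq_0 laurent_lookup_monomial lookup_add lookup_zero mult_minus1 diff_zero)
  qed
  \<comment> \<open>The image is a submodule by the intertwining property, and it contains w = h(1),
    so simplicity applies.\<close>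
  moreover have "range h = carrier M"
  proof -
    have "submodule (range h) L M"
    proof (intro submodule.intro submodule_axioms.intro M.add.subgroupI)
      fix v assume "v \<in> range h"
      then obtain f where f: "v = h f" by blast
      have "\<ominus>\<^bsub>M\<^esub> v = h (Poly_Mapping.single 0 (- 1) * f)"
        by (simp add: f h_scale scale_minus_one)
      then show "\<ominus>\<^bsub>M\<^esub> v \<in> range h" by blast
    qed (auto simp flip: h_add intertwine)
    then have "range h = {\<zero>\<^bsub>M\<^esub>} \<or> range h = carrier M"
      using simple by (simp add: simple_module_def)
    moreover have "h (Poly_Mapping.single 0 1) = w" using w h_single[of 0 1] by simp
    then have "w \<in> range h" by (metis rangeI)
    ultimately show ?thesis using w by auto
  qed
  ultimately have "bij_betw h UNIV (carrier M)" by (simp add: bij_betw_def)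
  then have "module_isomorphic L (twist \<tau> ?V) M"
    unfolding module_isomorphic_def using h_add intertwine by (intro exI[of _ h]) simp
  then show ?thesis using \<tau>(1) by blast
qed

end

section \<open>Modules with an eigenvector of a monomial\<close>

lemma free_peval_monom_minus_const:
  assumes "m > 0"
  shows "free_peval r (monom 1 m - [:\<mu>:]) = r ^ m - Poly_Mapping.single [] \<mu>"
proof -
  have deg: "degree (monom 1 m - [:\<mu>:]) \<le> m"
    by (intro degree_diff_le) (simp_all add: degree_monom_eq)
  have "free_peval r (monom 1 m - [:\<mu>:]) =
      (\<Sum>i\<le>m. (if i = m then r ^ m else 0) - (if i = 0 then Poly_Mapping.single [] \<mu> else 0))"
    unfolding free_peval_superset[OF deg] using assms
    by (intro sum.cong) (auto simp: coeff_pCons single_diff left_diff_distrib split: nat.splits simp flip: one_free)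
  also have "\<dots> = r ^ m - Poly_Mapping.single [] \<mu>"
    by (simp add: sum_subtractf)
  finally show ?thesis .
qed

context torus_algebra
begin

lemma torus_class_power: "torus_class q (r ^ n) = torus_class q r [^]\<^bsub>L\<^esub> n"
proof (induction n)
  case 0
  show ?case by (simp add: torus_simps(4))
next
  case (Suc n)
  then show ?case by (simp add: power_Suc2 del: power_Suc flip: torus_simps(1))
qed

lemma y_power_x: "\<exists>c. c \<noteq> 0 \<and> y [^]\<^bsub>L\<^esub> (n :: nat) \<otimes>\<^bsub>L\<^esub> x = c \<odot>\<^bsub>L\<^esub> (x \<otimes>\<^bsub>L\<^esub> y [^]\<^bsub>L\<^esub> n)"
proof (induction n)
  case 0
  show ?case by (intro exI[of _ 1]) simp
next
  case (Suc n)
  then obtain c where c: "c \<noteq> 0" "y [^]\<^bsub>L\<^esub> n \<otimes>\<^bsub>L\<^esub> x = c \<odot>\<^bsub>L\<^esub> (x \<otimes>\<^bsub>L\<^esub> y [^]\<^bsub>L\<^esub> n)" by blast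
  have "y [^]\<^bsub>L\<^esub> Suc n \<otimes>\<^bsub>L\<^esub> x = inverse q \<odot>\<^bsub>L\<^esub> (y [^]\<^bsub>L\<^esub> n \<otimes>\<^bsub>L\<^esub> x \<otimes>\<^bsub>L\<^esub> y)"
    by (simp add: m_assoc normal_order smult_mult_right)
  also have "\<dots> = (inverse q * c) \<odot>\<^bsub>L\<^esub> (x \<otimes>\<^bsub>L\<^esub> y [^]\<^bsub>L\<^esub> Suc n)"
    by (simp add: c m_assoc smult_mult_left smult_assoc)
  finally show ?case using c(1) q_nonzero by (intro exI[of _ "inverse q * c"]) simp
qed

text \<open>The scalar is q^(-n(n-1)/2), from moving each \<open>x\<close> to the left past the
  powers of \<open>y\<close> before it. It is left existential because it only gets absorbed into an
  eigenvalue.\<close>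

lemma xy_power:
  "\<exists>c. c \<noteq> 0 \<and> (x \<otimes>\<^bsub>L\<^esub> y) [^]\<^bsub>L\<^esub> (n :: nat) = c \<odot>\<^bsub>L\<^esub> (x [^]\<^bsub>L\<^esub> n \<otimes>\<^bsub>L\<^esub> y [^]\<^bsub>L\<^esub> n)"
proof (induction n)
  case 0
  show ?case by (intro exI[of _ 1]) simp
next
  case (Suc n)
  then obtain c where c: "c \<noteq> 0"
      "(x \<otimes>\<^bsub>L\<^esub> y) [^]\<^bsub>L\<^esub> n = c \<odot>\<^bsub>L\<^esub> (x [^]\<^bsub>L\<^esub> n \<otimes>\<^bsub>L\<^esub> y [^]\<^bsub>L\<^esub> n)" by blast
  obtain d where d: "d \<noteq> 0" "y [^]\<^bsub>L\<^esub> n \<otimes>\<^bsub>L\<^esub> x = d \<odot>\<^bsub>L\<^esub> (x \<otimes>\<^bsub>L\<^esub> y [^]\<^bsub>L\<^esub> n)"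
    using y_power_x by blast
  have "(x \<otimes>\<^bsub>L\<^esub> y) [^]\<^bsub>L\<^esub> Suc n = c \<odot>\<^bsub>L\<^esub> (x [^]\<^bsub>L\<^esub> n \<otimes>\<^bsub>L\<^esub> (y [^]\<^bsub>L\<^esub> n \<otimes>\<^bsub>L\<^esub> x) \<otimes>\<^bsub>L\<^esub> y)"
    by (simp add: c m_assoc smult_mult_left)
  also have "\<dots> = (c * d) \<odot>\<^bsub>L\<^esub> (x [^]\<^bsub>L\<^esub> Suc n \<otimes>\<^bsub>L\<^esub> y [^]\<^bsub>L\<^esub> Suc n)"
    by (simp add: d m_assoc smult_mult_left smult_mult_right smult_assoc)
  finally show ?case using c(1) d(1) by (intro exI[of _ "c * d"]) simp
qed

end

context torus_module
begin

text \<open>X^m - \<mu> is a nonzero polynomial that kills \<open>w\<close> when evaluated at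
  \<open>x\<close>, so its linear factors provide an eigenvector of \<open>x\<close> itself.\<close>

lemma isomorphic_of_x_power_eigenvector:
  assumes simple: "simple_module L M" and generic: "generic q" and "m > 0"
    and w: "w \<in> carrier M" "w \<noteq> \<zero>\<^bsub>M\<^esub>" "x [^]\<^bsub>L\<^esub> (m :: nat) \<odot>\<^bsub>M\<^esub> w = scale \<mu> w"
  shows "\<exists>\<tau> \<in> algebra_automorphisms L. module_isomorphic L (twist \<tau> (basic_module q)) M"
proof -
  let ?p = "Polynomial.monom 1 m - [:\<mu>:] :: complex poly"
  let ?r = "free_gen GX"
  have "Polynomial.coeff ?p m = 1" using \<open>m > 0\<close> by (simp add: coeff_pCons split: nat.splits)
  then have "?p \<noteq> 0" by (metis coeff_0 zero_neq_one)
  moreover have "torus_class q (free_peval ?r ?p) \<odot>\<^bsub>M\<^esub> w = \<zero>\<^bsub>M\<^esub>"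
  proof -
    have "torus_class q (?r ^ m) = torus_class q (?r ^ m - Poly_Mapping.single [] \<mu>) \<oplus>\<^bsub>L\<^esub>
        torus_class q (Poly_Mapping.single [] \<mu>)"
      by (simp add: torus_simps)
    then have "scale \<mu> w = torus_class q (?r ^ m - Poly_Mapping.single [] \<mu>) \<odot>\<^bsub>M\<^esub> w \<oplus>\<^bsub>M\<^esub> scale \<mu> w"
      using w by (simp add: torus_class_power act_l_distr torus_class_scalar)
    then show ?thesis
      using w(1) \<open>m > 0\<close> M.add.r_cancel_one'[of "scale \<mu> w"]
      by (simp add: free_peval_monom_minus_const)
  qed
  ultimately obtain v z where "v \<in> carrier M" "v \<noteq> \<zero>\<^bsub>M\<^esub>" "x \<odot>\<^bsub>M\<^esub> v = scale z v"
    using eigenvector_of_annihilating_poly[OF _ w(1,2)] by blast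
  then show ?thesis using isomorphic_of_x_eigenvector[OF simple generic] by blast
qed

end

context torus_algebra
begin

lemma isomorphic_untwist:
  assumes "\<epsilon> \<in> algebra_automorphisms L"
    and "\<exists>\<tau> \<in> algebra_automorphisms L. module_isomorphic L (twist \<tau> V) (twist \<epsilon> M)"
  shows "\<exists>\<tau> \<in> algebra_automorphisms L. module_isomorphic L (twist \<tau> V) M"
  using assms module_isomorphic_untwist[OF complex_algebra_axioms]
    algebra_automorphisms_comp algebra_automorphisms_inv[OF complex_algebra_axioms] by blast

lemma automorphism_monomial:
  assumes "\<epsilon> \<in> algebra_automorphisms L"
  shows "\<epsilon> (x [^]\<^bsub>L\<^esub> (m :: nat) \<otimes>\<^bsub>L\<^esub> y [^]\<^bsub>L\<^esub> (n :: nat)) = \<epsilon> x [^]\<^bsub>L\<^esub> m \<otimes>\<^bsub>L\<^esub> \<epsilon> y [^]\<^bsub>L\<^esub> n"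
    and "\<epsilon> (c \<odot>\<^bsub>L\<^esub> \<one>\<^bsub>L\<^esub>) = c \<odot>\<^bsub>L\<^esub> \<one>\<^bsub>L\<^esub>"
proof -
  have hom: "\<epsilon> \<in> ring_hom L L" and lin: "\<And>c a. a \<in> carrier L \<Longrightarrow> \<epsilon> (c \<odot>\<^bsub>L\<^esub> a) = c \<odot>\<^bsub>L\<^esub> \<epsilon> a"
    using assms by (auto simp: algebra_automorphisms_def ring_iso_def)
  have pow: "\<epsilon> (a [^]\<^bsub>L\<^esub> k) = \<epsilon> a [^]\<^bsub>L\<^esub> k" if "a \<in> carrier L" for a and k :: nat
    by (induction k) (use that in \<open>simp_all add: ring_hom_one[OF hom] ring_hom_mult[OF hom]\<close>)
  show "\<epsilon> (x [^]\<^bsub>L\<^esub> m \<otimes>\<^bsub>L\<^esub> y [^]\<^bsub>L\<^esub> n) = \<epsilon> x [^]\<^bsub>L\<^esub> m \<otimes>\<^bsub>L\<^esub> \<epsilon> y [^]\<^bsub>L\<^esub> n"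
    by (simp add: ring_hom_mult[OF hom] pow)
  show "\<epsilon> (c \<odot>\<^bsub>L\<^esub> \<one>\<^bsub>L\<^esub>) = c \<odot>\<^bsub>L\<^esub> \<one>\<^bsub>L\<^esub>"
    by (simp add: lin ring_hom_one[OF hom])
qed

text \<open>Euclid's algorithm on the exponents, each step being a twist by a shear.\<close>

lemma isomorphic_of_monomial_eigenvector:
  assumes generic: "generic q" and "(m, n) \<noteq> (0, 0)"
    and "simple_module L M" "w \<in> carrier M" "w \<noteq> \<zero>\<^bsub>M\<^esub>"
      "(x [^]\<^bsub>L\<^esub> (m :: nat) \<otimes>\<^bsub>L\<^esub> y [^]\<^bsub>L\<^esub> (n :: nat)) \<odot>\<^bsub>M\<^esub> w = (\<mu> \<odot>\<^bsub>L\<^esub> \<one>\<^bsub>L\<^esub>) \<odot>\<^bsub>M\<^esub> w"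
  shows "\<exists>\<tau> \<in> algebra_automorphisms L. module_isomorphic L (twist \<tau> (basic_module q)) M"
  using assms(2-)
proof (induction "m + n" arbitrary: m n M \<mu> rule: less_induct)
  case less
  interpret torus_module q M
    using less.prems(2) by (intro torus_module.intro torus_algebra_axioms) (simp add: simple_module_def)
  note w = less.prems(3-)
  let ?D = "x [^]\<^bsub>L\<^esub> m \<otimes>\<^bsub>L\<^esub> y [^]\<^bsub>L\<^esub> n"
  \<comment> \<open>Equal nonzero exponents fall under the third case and lead to (0, n), which the
    rotation settles.\<close>
  consider "n = 0" | "m = 0" "n \<noteq> 0" | "n \<noteq> 0" "n \<le> m" | "m \<noteq> 0" "m < n" by linarith
  then show ?case
  proof cases
    case 1
    then show ?thesis
      using isomorphic_of_x_power_eigenvector[OF less.prems(2) generic _ w(1,2), of m] w(3) less.prems(1)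
      by simp
  next
    case 2
    obtain \<epsilon> where \<epsilon>: "\<epsilon> \<in> algebra_automorphisms L" "\<epsilon> x = y" "\<epsilon> y = xi"
      by (rule automorphism_rotation)
    \<comment> \<open>In the twisted module x^n acts as y^n does on \<open>M\<close>, so
      \<open>w\<close> is an eigenvector of a pure power of \<open>x\<close> there.\<close>
    have "\<epsilon> (x [^]\<^bsub>L\<^esub> n) = y [^]\<^bsub>L\<^esub> n"
      using automorphism_monomial(1)[OF \<epsilon>(1), of n 0] by (simp add: \<epsilon>(2,3))
    then have eigen: "x [^]\<^bsub>L\<^esub> n \<odot>\<^bsub>twist \<epsilon> M\<^esub> w = \<epsilon> (\<mu> \<odot>\<^bsub>L\<^esub> \<one>\<^bsub>L\<^esub>) \<odot>\<^bsub>M\<^esub> w"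
      using w(1,3) unfolding automorphism_monomial(2)[OF \<epsilon>(1)] by (simp add: \<open>m = 0\<close>)
    have simple: "simple_module L (twist \<epsilon> M)" by (rule simple_module_twist[OF less.prems(2) \<epsilon>(1)])
    interpret T: torus_module q "twist \<epsilon> M"
      using simple by (intro torus_module.intro torus_algebra_axioms) (simp add: simple_module_def)
    show ?thesis
    proof (rule isomorphic_untwist[OF \<epsilon>(1) T.isomorphic_of_x_power_eigenvector[OF simple generic]])
      show "x [^]\<^bsub>L\<^esub> n \<odot>\<^bsub>twist \<epsilon> M\<^esub> w = T.scale \<mu> w"
        using eigen by (simp only: twist_simps)
    qed (use \<open>n \<noteq> 0\<close> w in simp_all)
  next
    case 3
    obtain \<epsilon> where \<epsilon>: "\<epsilon> \<in> algebra_automorphisms L" "\<epsilon> x = x" "\<epsilon> y = x \<otimes>\<^bsub>L\<^esub> y"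
      by (rule automorphism_shear_y)
    obtain c where c: "(x \<otimes>\<^bsub>L\<^esub> y) [^]\<^bsub>L\<^esub> n = c \<odot>\<^bsub>L\<^esub> (x [^]\<^bsub>L\<^esub> n \<otimes>\<^bsub>L\<^esub> y [^]\<^bsub>L\<^esub> n)"
      using xy_power by blast
    \<comment> \<open>The left side is the image under \<epsilon> of x^(m-n) y^n. Hence
      \<open>w\<close> remains an eigenvector in the twisted module, now with eigenvalue
      \<open>c * \<mu>\<close>, while the sum of the exponents drops by \<open>n\<close>.\<close>
    have "x [^]\<^bsub>L\<^esub> (m - n) \<otimes>\<^bsub>L\<^esub> (x \<otimes>\<^bsub>L\<^esub> y) [^]\<^bsub>L\<^esub> n = c \<odot>\<^bsub>L\<^esub> (x [^]\<^bsub>L\<^esub> m \<otimes>\<^bsub>L\<^esub> y [^]\<^bsub>L\<^esub> n)"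
      using 3 by (simp add: c smult_mult_right nat_pow_mult flip: m_assoc)
    then have eigen: "(x [^]\<^bsub>L\<^esub> (m - n) \<otimes>\<^bsub>L\<^esub> y [^]\<^bsub>L\<^esub> n) \<odot>\<^bsub>twist \<epsilon> M\<^esub> w = scale (c * \<mu>) w"
      using w by (simp add: automorphism_monomial[OF \<epsilon>(1)] \<epsilon>(2,3) smult_act[of ?D])
    show ?thesis
    proof (rule isomorphic_untwist[OF \<epsilon>(1) less.hyps[OF _ _ simple_module_twist[OF less.prems(2) \<epsilon>(1)]]])
      show "(x [^]\<^bsub>L\<^esub> (m - n) \<otimes>\<^bsub>L\<^esub> y [^]\<^bsub>L\<^esub> n) \<odot>\<^bsub>twist \<epsilon> M\<^esub> w = ((c * \<mu>) \<odot>\<^bsub>L\<^esub> \<one>\<^bsub>L\<^esub>) \<odot>\<^bsub>twist \<epsilon> M\<^esub> w"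
        using eigen by (simp only: twist_simps automorphism_monomial(2)[OF \<epsilon>(1)])
    qed (use 3 w(1,2) in simp_all)
  next
    case 4
    obtain \<epsilon> where \<epsilon>: "\<epsilon> \<in> algebra_automorphisms L" "\<epsilon> x = x \<otimes>\<^bsub>L\<^esub> y" "\<epsilon> y = y"
      by (rule automorphism_shear_x)
    obtain c where c: "(x \<otimes>\<^bsub>L\<^esub> y) [^]\<^bsub>L\<^esub> m = c \<odot>\<^bsub>L\<^esub> (x [^]\<^bsub>L\<^esub> m \<otimes>\<^bsub>L\<^esub> y [^]\<^bsub>L\<^esub> m)"
      using xy_power by blast
    \<comment> \<open>Likewise for the image of x^m y^(n-m); the sum of the exponents drops by
      \<open>m\<close>.\<close>
    have "(x \<otimes>\<^bsub>L\<^esub> y) [^]\<^bsub>L\<^esub> m \<otimes>\<^bsub>L\<^esub> y [^]\<^bsub>L\<^esub> (n - m) = c \<odot>\<^bsub>L\<^esub> (x [^]\<^bsub>L\<^esub> m \<otimes>\<^bsub>L\<^esub> y [^]\<^bsub>L\<^esub> n)"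
      using 4 by (simp add: c smult_mult_left nat_pow_mult m_assoc)
    then have eigen: "(x [^]\<^bsub>L\<^esub> m \<otimes>\<^bsub>L\<^esub> y [^]\<^bsub>L\<^esub> (n - m)) \<odot>\<^bsub>twist \<epsilon> M\<^esub> w = scale (c * \<mu>) w"
      using w by (simp add: automorphism_monomial[OF \<epsilon>(1)] \<epsilon>(2,3) smult_act[of ?D])
    show ?thesis
    proof (rule isomorphic_untwist[OF \<epsilon>(1) less.hyps[OF _ _ simple_module_twist[OF less.prems(2) \<epsilon>(1)]]])
      show "(x [^]\<^bsub>L\<^esub> m \<otimes>\<^bsub>L\<^esub> y [^]\<^bsub>L\<^esub> (n - m)) \<odot>\<^bsub>twist \<epsilon> M\<^esub> w = ((c * \<mu>) \<odot>\<^bsub>L\<^esub> \<one>\<^bsub>L\<^esub>) \<odot>\<^bsub>twist \<epsilon> M\<^esub> w"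
        using eigen by (simp only: twist_simps automorphism_monomial(2)[OF \<epsilon>(1)])
    qed (use 4 w(1,2) in simp_all)
  qed
qed

end

section \<open>Modules over the quantum plane\<close>

text \<open>Gaussian elimination, by induction on the set \<open>B\<close> of equations: an equation
  with zero coefficients is dropped, any other one is used to eliminate one unknown.\<close>

lemma homogeneous_system_nontrivial:
  fixes c :: "'i \<Rightarrow> 'b \<Rightarrow> complex"
  assumes "finite B" "finite I" "card B < card I"
  shows "\<exists>a. (\<exists>i\<in>I. a i \<noteq> 0) \<and> (\<forall>b\<in>B. (\<Sum>i\<in>I. a i * c i b) = 0)"
  using assms
proof (induction B arbitrary: I c rule: finite_induct)
  case empty
  then have "I \<noteq> {}" by auto
  then show ?case by (intro exI[of _ "\<lambda>_. 1"]) auto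
next
  case (insert b\<^sub>0 B)
  show ?case
  proof (cases "\<forall>i\<in>I. c i b\<^sub>0 = 0")
    case True
    obtain a where "\<exists>i\<in>I. a i \<noteq> 0" "\<forall>b\<in>B. (\<Sum>i\<in>I. a i * c i b) = 0"
      using insert.IH[of I c] insert.prems insert.hyps by auto
    then show ?thesis using True by (intro exI[of _ a]) auto
  next
    case False
    then obtain i\<^sub>0 where i: "i\<^sub>0 \<in> I" "c i\<^sub>0 b\<^sub>0 \<noteq> 0" by blast
    let ?J = "I - {i\<^sub>0}"
    \<comment> \<open>The coefficients that remain after the unknown \<open>i\<^sub>0\<close> has
      been solved for from equation \<open>b\<^sub>0\<close> and substituted.\<close>
    define d where "d i b = c i b - c i b\<^sub>0 / c i\<^sub>0 b\<^sub>0 * c i\<^sub>0 b" for i b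
    have "card B < card ?J"
      using insert.prems insert.hyps i by (simp add: card_Diff_singleton)
    then obtain a where a: "\<exists>i\<in>?J. a i \<noteq> 0" "\<forall>b\<in>B. (\<Sum>i\<in>?J. a i * d i b) = 0"
      using insert.IH[of ?J d] insert.prems by auto
    \<comment> \<open>The value of the eliminated unknown that makes equation
      \<open>b\<^sub>0\<close> hold.\<close>
    define e where "e = - (\<Sum>i\<in>?J. a i * c i b\<^sub>0) / c i\<^sub>0 b\<^sub>0"
    have *: "(\<Sum>i\<in>I. (a(i\<^sub>0 := e)) i * c i b) = (\<Sum>i\<in>?J. a i * c i b) + e * c i\<^sub>0 b" for b
      using insert.prems(1) i by (simp add: sum.remove[of I i\<^sub>0] add.commute)
    have "(\<Sum>i\<in>I. (a(i\<^sub>0 := e)) i * c i b) = (\<Sum>i\<in>?J. a i * d i b)" for b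
      unfolding * unfolding d_def e_def
      by (simp add: right_diff_distrib sum_subtractf sum_distrib_right sum_divide_distrib sum_negf mult.assoc)
    moreover have "(\<Sum>i\<in>I. (a(i\<^sub>0 := e)) i * c i b\<^sub>0) = 0"
      unfolding * using i by (simp add: e_def)
    ultimately show ?thesis
      using a by (intro exI[of _ "a(i\<^sub>0 := e)"]) auto
  qed
qed

text \<open>The identity behind it is \<open>1 \<otimes> v = s\<^sup>-\<^sup>1 \<otimes> s v\<close>.\<close>

lemma localisation_unit_eq_of_annihilated:
  assumes A: "complex_algebra A" and M: "left_module A M"
    and S: "S \<subseteq> carrier A" "s \<in> S" and v: "v \<in> carrier M" "s \<odot>\<^bsub>M\<^esub> v = \<zero>\<^bsub>M\<^esub>"
  shows "localisation_unit A S M v = localisation_unit A S M \<zero>\<^bsub>M\<^esub>"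
proof -
  interpret M: left_module A M by fact
  let ?G = "localisation_gens A S" and ?R = "localisation_rels A S" and ?B = "localisation A S"
  let ?\<iota> = "localisation_map A S"
  let ?F = "free_Abelian_group (carrier ?B \<times> carrier M)"
  let ?T = "tensor_rel_group A ?\<iota> ?B M"
  interpret B: complex_algebra ?B by (rule complex_algebra_localisation[OF A S(1)])
  have rels: "?R \<subseteq> carrier (free_algebra ?G)" by (rule localisation_rels_closed[OF A S(1)])
  interpret G: complex_algebra "free_algebra ?G" by (rule complex_algebra_free_algebra)
  have gen: "free_gen g \<in> carrier (free_algebra ?G)" if "g \<in> ?G" for g
    using that by (simp add: free_gen_def)
  have cls: "presented_class ?G ?R f \<in> carrier ?B" if "f \<in> carrier (free_algebra ?G)" for f
    unfolding localisation_def presented_simps(5)[OF rels] using that by blast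
  have \<iota>: "?\<iota> a \<in> carrier ?B" if "a \<in> carrier A" for a
    unfolding localisation_map_def using that by (intro cls gen) (simp add: localisation_gens_def)
  \<comment> \<open>The formal inverse of \<open>s\<close> in the localisation.\<close>
  define b where "b = presented_class ?G ?R (free_gen (Inr s))"
  have s: "Inr s \<in> ?G" "Inl s \<in> ?G" "s \<in> carrier A"
    using S by (auto simp: localisation_gens_def)
  have b: "b \<in> carrier ?B" unfolding b_def by (intro cls gen s)
  have "b \<otimes>\<^bsub>?B\<^esub> ?\<iota> s = presented_class ?G ?R (free_gen (Inr s) * free_gen (Inl s))"
    unfolding b_def localisation_map_def localisation_def
    by (intro presented_simps(1)[OF rels] gen s)
  also have "\<dots> = presented_class ?G ?R 1"
  proof (rule presented_class_eqI[OF rels])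
    have "free_gen (Inr s) * free_gen (Inl s) - 1 \<in> ?R"
      using S(2) by (auto simp: localisation_rels_def)
    then show "free_gen (Inr s) * free_gen (Inl s) - 1 \<in> relation_ideal ?G ?R"
      using relation_ideal(2)[OF rels] by blast
  qed (use free_mult_closed[OF gen gen] s G.one_closed in \<open>simp_all del: free_algebra_simps(1)\<close>)
  also have "\<dots> = \<one>\<^bsub>?B\<^esub>"
    unfolding localisation_def presented_simps(4)[OF rels] ..
  finally have inverse: "b \<otimes>\<^bsub>?B\<^esub> ?\<iota> s = \<one>\<^bsub>?B\<^esub>" .
  have "tensor_rels A ?\<iota> ?B M \<subseteq> carrier ?F"
  proof -
    have "frag_of (c, u) \<in> carrier ?F" if "c \<in> carrier ?B" "u \<in> carrier M" for c u
      using that by simp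
    moreover have "f + g \<in> carrier ?F" "f - g \<in> carrier ?F"
      if "f \<in> carrier ?F" "g \<in> carrier ?F" for f g
      using that Poly_Mapping.keys_add[of f g] keys_diff[of f g] by (auto simp: carrier_free_Abelian_group_iff)
    ultimately show ?thesis
      unfolding tensor_rels_def using \<iota> by (auto simp del: carrier_free_Abelian_group_iff)
  qed
  then have T: "subgroup ?T ?F"
    unfolding tensor_rel_group_def
    by (intro group.generate_is_subgroup) auto
  \<comment> \<open>1 (x) u = b s (x) u = b (x) s u = b (x) 0, by the balancing relations. It is
    used for \<open>v\<close> and for zero; in the difference the term b (x) 0 cancels.\<close>
  have rel: "frag_of (\<one>\<^bsub>?B\<^esub>, u) - frag_of (b, \<zero>\<^bsub>M\<^esub>) \<in> ?T"
    if "u \<in> carrier M" "s \<odot>\<^bsub>M\<^esub> u = \<zero>\<^bsub>M\<^esub>" for u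
  proof -
    have "frag_of (b \<otimes>\<^bsub>?B\<^esub> ?\<iota> s, u) - frag_of (b, s \<odot>\<^bsub>M\<^esub> u) \<in> tensor_rels A ?\<iota> ?B M"
      unfolding tensor_rels_def using b s that(1) by blast
    then show ?thesis
      using that unfolding tensor_rel_group_def by (auto simp: inverse intro: generate.incl)
  qed
  have zero: "s \<odot>\<^bsub>M\<^esub> \<zero>\<^bsub>M\<^esub> = \<zero>\<^bsub>M\<^esub>"
    using M.act_r_distr[of s "\<zero>\<^bsub>M\<^esub>" "\<zero>\<^bsub>M\<^esub>"] M.M.add.r_cancel_one[of "s \<odot>\<^bsub>M\<^esub> \<zero>\<^bsub>M\<^esub>" "s \<odot>\<^bsub>M\<^esub> \<zero>\<^bsub>M\<^esub>"] s by simp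
  have diff: "f - g \<in> ?T" if "f \<in> ?T" "g \<in> ?T" for f g
  proof -
    have "g \<in> carrier ?F" using T that(2) by (rule subgroup.mem_carrier)
    then show ?thesis
      using subgroup.m_closed[OF T that(1) subgroup.m_inv_closed[OF T that(2)]] by simp
  qed
  have "frag_of (\<one>\<^bsub>?B\<^esub>, v) - frag_of (\<one>\<^bsub>?B\<^esub>, \<zero>\<^bsub>M\<^esub>) \<in> ?T"
    using diff[OF rel[OF v] rel[OF M.M.zero_closed zero]] by simp
  then have "frag_of (\<one>\<^bsub>?B\<^esub>, v) \<in> ?T #>\<^bsub>?F\<^esub> frag_of (\<one>\<^bsub>?B\<^esub>, \<zero>\<^bsub>M\<^esub>)"
    unfolding r_coset_def by force
  then have "?T #>\<^bsub>?F\<^esub> frag_of (\<one>\<^bsub>?B\<^esub>, \<zero>\<^bsub>M\<^esub>) = ?T #>\<^bsub>?F\<^esub> frag_of (\<one>\<^bsub>?B\<^esub>, v)"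
    using T by (intro group.repr_independence) auto
  then show ?thesis
    by (simp add: localisation_unit_def pure_tensor_def)
qed

section \<open>The quantum plane inside the torus\<close>

context torus_algebra
begin

abbreviation "P \<equiv> quantum_plane q"

lemma plane_simps [simp]:
  "monoid.mult P = monoid.mult L" "ring.add P = ring.add L" "monoid.one P = monoid.one L" "ring.zero P = ring.zero L" "module.smult P = module.smult L"
  by (simp_all add: quantum_plane_def)

lemma plane_carrier: "carrier P = generated_subalgebra L {x, y}"
  by (simp add: quantum_plane_def)

text \<open>Plane and torus differ only in the carrier. The rewrites state all facts about
  \<open>P\<close> with the operations of \<open>L\<close>, so that both sets of rules
  combine.\<close>

sublocale P: complex_algebra P
  rewrites "monoid.mult P = monoid.mult L" and "ring.add P = ring.add L" and "monoid.one P = monoid.one L" and "ring.zero P = ring.zero L"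
    and "module.smult P = module.smult L"
  by (rule complex_algebra_quantum_plane) simp_all

lemma plane_gens [simp]: "x \<in> carrier P" "y \<in> carrier P"
  by (auto simp: plane_carrier generated_subalgebra_def)

lemma plane_subset: "u \<in> carrier P \<Longrightarrow> u \<in> carrier L"
  unfolding plane_carrier generated_subalgebra_def
  using carrier_is_subring by (auto dest!: spec[of _ "carrier L"])

lemma plane_pow [simp]: "u [^]\<^bsub>P\<^esub> (n :: nat) = u [^]\<^bsub>L\<^esub> n"
  by (simp add: nat_pow_def)

text \<open>The elements with property \<open>Q\<close> form a subalgebra that contains
  \<open>x\<close> and \<open>y\<close>.\<close>

lemma plane_induct [consumes 1, case_names x y one scale add mult]:
  assumes "u \<in> carrier P"
    and "Q x" "Q y" "Q \<one>\<^bsub>L\<^esub>"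
    and "\<And>c u. u \<in> carrier P \<Longrightarrow> Q u \<Longrightarrow> Q (c \<odot>\<^bsub>L\<^esub> u)"
    and "\<And>u v. u \<in> carrier P \<Longrightarrow> v \<in> carrier P \<Longrightarrow> Q u \<Longrightarrow> Q v \<Longrightarrow> Q (u \<oplus>\<^bsub>L\<^esub> v)"
    and "\<And>u v. u \<in> carrier P \<Longrightarrow> v \<in> carrier P \<Longrightarrow> Q u \<Longrightarrow> Q v \<Longrightarrow> Q (u \<otimes>\<^bsub>L\<^esub> v)"
  shows "Q u"
proof -
  let ?K = "{u \<in> carrier P. Q u}"
  have "subring ?K L"
  proof (rule subringI)
    fix u assume u: "u \<in> ?K"
    then have uL: "u \<in> carrier L" by (simp add: plane_subset)
    \<comment> \<open>Closure under negation is not among the premises; it comes from scaling by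
      -1.\<close>
    have "(- 1) \<odot>\<^bsub>L\<^esub> u \<oplus>\<^bsub>L\<^esub> 1 \<odot>\<^bsub>L\<^esub> u = 0 \<odot>\<^bsub>L\<^esub> u"
      using smult_l_distr[OF uL, of "- 1" 1] by simp
    moreover have "0 \<odot>\<^bsub>L\<^esub> u = \<zero>\<^bsub>L\<^esub>"
      using smult_l_distr[OF uL, of 0 0] add.r_cancel_one[of "0 \<odot>\<^bsub>L\<^esub> u" "0 \<odot>\<^bsub>L\<^esub> u"] uL by simp
    ultimately have "\<ominus>\<^bsub>L\<^esub> u = (- 1) \<odot>\<^bsub>L\<^esub> u"
      using uL by (intro minus_equality) simp_all
    then show "\<ominus>\<^bsub>L\<^esub> u \<in> ?K" using u assms(5) by simp
  qed (use assms plane_subset in auto)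
  then have "carrier P \<subseteq> ?K"
    using assms(2-5) by (subst plane_carrier) (auto simp: generated_subalgebra_def)
  then show ?thesis using assms(1) by blast
qed

end

section \<open>From the plane to the torus: invertibility of x and y\<close>

locale plane_module = torus_algebra q + left_module "quantum_plane q" M
  for q and M :: "(torus_elem, 'v) module"
begin

abbreviation scale :: "complex \<Rightarrow> 'v \<Rightarrow> 'v" where
  "scale c v \<equiv> (c \<odot>\<^bsub>L\<^esub> \<one>\<^bsub>L\<^esub>) \<odot>\<^bsub>M\<^esub> v"

lemma plane_act_closed [simp]: "u \<in> carrier P \<Longrightarrow> v \<in> carrier M \<Longrightarrow> u \<odot>\<^bsub>M\<^esub> v \<in> carrier M"
  by (rule act_closed)

lemma plane_act_one [simp]: "v \<in> carrier M \<Longrightarrow> \<one>\<^bsub>L\<^esub> \<odot>\<^bsub>M\<^esub> v = v"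
  using act_one by simp

lemma plane_act_l_distr:
  "u \<in> carrier P \<Longrightarrow> u' \<in> carrier P \<Longrightarrow> v \<in> carrier M \<Longrightarrow>
    (u \<oplus>\<^bsub>L\<^esub> u') \<odot>\<^bsub>M\<^esub> v = u \<odot>\<^bsub>M\<^esub> v \<oplus>\<^bsub>M\<^esub> u' \<odot>\<^bsub>M\<^esub> v"
  using act_l_distr[of u u' v] by simp

lemma plane_act_mult:
  "u \<in> carrier P \<Longrightarrow> u' \<in> carrier P \<Longrightarrow> v \<in> carrier M \<Longrightarrow>
    (u \<otimes>\<^bsub>L\<^esub> u') \<odot>\<^bsub>M\<^esub> v = u \<odot>\<^bsub>M\<^esub> (u' \<odot>\<^bsub>M\<^esub> v)"
  using act_assoc[of u u' v] by simp

lemma plane_act_zero [simp]: "u \<in> carrier P \<Longrightarrow> u \<odot>\<^bsub>M\<^esub> \<zero>\<^bsub>M\<^esub> = \<zero>\<^bsub>M\<^esub>"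
  using act_r_distr[of u "\<zero>\<^bsub>M\<^esub>" "\<zero>\<^bsub>M\<^esub>"] M.add.r_cancel_one[of "u \<odot>\<^bsub>M\<^esub> \<zero>\<^bsub>M\<^esub>" "u \<odot>\<^bsub>M\<^esub> \<zero>\<^bsub>M\<^esub>"] by simp

lemma plane_act_smult:
  assumes "u \<in> carrier P" "v \<in> carrier M"
  shows "(c \<odot>\<^bsub>L\<^esub> u) \<odot>\<^bsub>M\<^esub> v = scale c (u \<odot>\<^bsub>M\<^esub> v)" "(c \<odot>\<^bsub>L\<^esub> u) \<odot>\<^bsub>M\<^esub> v = u \<odot>\<^bsub>M\<^esub> scale c v"
  using assms P.one_closed P.smult_closed P.smult_mult_left[of "\<one>\<^bsub>L\<^esub>" u c] P.smult_mult_right[of u "\<one>\<^bsub>L\<^esub>" c]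
  by (simp_all flip: plane_act_mult)

lemma act_inj_on:
  assumes "z \<in> carrier P" "\<And>v. v \<in> carrier M \<Longrightarrow> z \<odot>\<^bsub>M\<^esub> v = \<zero>\<^bsub>M\<^esub> \<Longrightarrow> v = \<zero>\<^bsub>M\<^esub>"
  shows "inj_on (\<lambda>v. z \<odot>\<^bsub>M\<^esub> v) (carrier M)"
proof (rule inj_onI)
  fix v w assume vw: "v \<in> carrier M" "w \<in> carrier M" "z \<odot>\<^bsub>M\<^esub> v = z \<odot>\<^bsub>M\<^esub> w"
  have "z \<odot>\<^bsub>M\<^esub> (v \<oplus>\<^bsub>M\<^esub> \<ominus>\<^bsub>M\<^esub> w) = z \<odot>\<^bsub>M\<^esub> (w \<oplus>\<^bsub>M\<^esub> \<ominus>\<^bsub>M\<^esub> w)"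
    using assms(1) vw by (simp add: act_r_distr)
  then have "v \<oplus>\<^bsub>M\<^esub> \<ominus>\<^bsub>M\<^esub> w = \<zero>\<^bsub>M\<^esub>"
    using assms(1) assms(2)[of "v \<oplus>\<^bsub>M\<^esub> \<ominus>\<^bsub>M\<^esub> w"] vw by (simp add: M.r_neg)
  then show "v = w"
    using vw M.minus_equality[of v "\<ominus>\<^bsub>M\<^esub> w"] by simp
qed

text \<open>The hypotheses let \<open>x\<close> and \<open>y\<close> be moved past \<open>z\<close>
  at the price of replacing them by \<open>a\<close> and \<open>b\<close>, so the image of
  \<open>z\<close> is stable under both generators and hence under the plane. It is meant for z = x
  and z = y.\<close>

lemma act_image_submodule:
  assumes z: "z \<in> carrier P" and a: "a \<in> carrier P" "x \<otimes>\<^bsub>L\<^esub> z = z \<otimes>\<^bsub>L\<^esub> a"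
    and b: "b \<in> carrier P" "y \<otimes>\<^bsub>L\<^esub> z = z \<otimes>\<^bsub>L\<^esub> b"
  shows "submodule ((\<lambda>v. z \<odot>\<^bsub>M\<^esub> v) ` carrier M) P M"
proof -
  let ?N = "(\<lambda>v. z \<odot>\<^bsub>M\<^esub> v) ` carrier M"
  have gen: "g \<odot>\<^bsub>M\<^esub> v \<in> ?N" if "v \<in> ?N" "g \<in> carrier P" "d \<in> carrier P" "g \<otimes>\<^bsub>L\<^esub> z = z \<otimes>\<^bsub>L\<^esub> d" for g d v
  proof -
    obtain w where w: "w \<in> carrier M" "v = z \<odot>\<^bsub>M\<^esub> w" using \<open>v \<in> ?N\<close> by blast
    have "g \<odot>\<^bsub>M\<^esub> v = z \<odot>\<^bsub>M\<^esub> (d \<odot>\<^bsub>M\<^esub> w)"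
      using that z w by (simp flip: plane_act_mult)
    then show ?thesis using that w by auto
  qed
  have sum: "v \<oplus>\<^bsub>M\<^esub> w \<in> ?N" if v: "v \<in> ?N" and w: "w \<in> ?N" for v w
  proof -
    obtain v' w' where "v' \<in> carrier M" "v = z \<odot>\<^bsub>M\<^esub> v'" "w' \<in> carrier M" "w = z \<odot>\<^bsub>M\<^esub> w'"
      using v w by blast
    then show ?thesis
      using z by (auto simp: act_r_distr intro!: image_eqI[of _ _ "v' \<oplus>\<^bsub>M\<^esub> w'"])
  qed
  have cl: "v \<in> carrier M" if "v \<in> ?N" for v using that z by auto
  have scale: "scale c v \<in> ?N" if "v \<in> ?N" for c v
  proof -
    obtain v' where v': "v' \<in> carrier M" "v = z \<odot>\<^bsub>M\<^esub> v'"
      using \<open>v \<in> ?N\<close> by blast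
    then have "scale c v = z \<odot>\<^bsub>M\<^esub> scale c v'"
      using z plane_act_smult[of z v' c] by simp
    then show ?thesis using v' P.one_closed P.smult_closed by auto
  qed
  have act: "u \<odot>\<^bsub>M\<^esub> v \<in> ?N" if "u \<in> carrier P" "v \<in> ?N" for u v
    using that
  proof (induction arbitrary: v rule: plane_induct)
    case x
    then show ?case using gen[OF _ plane_gens(1) a] by blast
  next
    case y
    then show ?case using gen[OF _ plane_gens(2) b] by blast
  next
    case one
    then show ?case using cl by simp
  next
    case (scale c u)
    then show ?case using cl[of v] \<open>\<And>c v. v \<in> ?N \<Longrightarrow> scale c v \<in> ?N\<close> by (simp add: plane_act_smult(1)[of u])
  next
    case (add u u')
    then show ?case using cl[of v] sum by (simp add: plane_act_l_distr)
  next
    case (mult u u')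
    then show ?case using cl[of v] by (simp add: plane_act_mult)
  qed
  show ?thesis
  proof (intro submodule.intro submodule_axioms.intro M.add.subgroupI)
    fix v assume v: "v \<in> ?N"
    then obtain v' where v': "v' \<in> carrier M" "v = z \<odot>\<^bsub>M\<^esub> v'" by blast
    have "z \<odot>\<^bsub>M\<^esub> (\<ominus>\<^bsub>M\<^esub> v') \<oplus>\<^bsub>M\<^esub> v = z \<odot>\<^bsub>M\<^esub> (\<ominus>\<^bsub>M\<^esub> v' \<oplus>\<^bsub>M\<^esub> v')"
      using z v' by (simp add: act_r_distr)
    then have "\<ominus>\<^bsub>M\<^esub> v = z \<odot>\<^bsub>M\<^esub> (\<ominus>\<^bsub>M\<^esub> v')"
      using z v' by (intro M.minus_equality) (simp_all add: M.l_neg)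
    then show "\<ominus>\<^bsub>M\<^esub> v \<in> ?N" using v' by simp
  qed (use sum act z in auto)
qed

text \<open>An injective \<open>z\<close> has nonzero image; when this image is a submodule,
  simplicity makes it everything.\<close>

lemma act_bij_betw:
  assumes simple: "simple_module P M"
    and inj: "\<And>v. v \<in> carrier M \<Longrightarrow> (x \<otimes>\<^bsub>L\<^esub> y) \<odot>\<^bsub>M\<^esub> v = \<zero>\<^bsub>M\<^esub> \<Longrightarrow> v = \<zero>\<^bsub>M\<^esub>"
  shows "bij_betw (\<lambda>v. x \<odot>\<^bsub>M\<^esub> v) (carrier M) (carrier M)" "bij_betw (\<lambda>v. y \<odot>\<^bsub>M\<^esub> v) (carrier M) (carrier M)"
proof -
  have nz: "carrier M \<noteq> {\<zero>\<^bsub>M\<^esub>}" using simple by (simp add: simple_module_def)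
  have bij: "bij_betw (\<lambda>v. z \<odot>\<^bsub>M\<^esub> v) (carrier M) (carrier M)"
    if z: "z \<in> carrier P" "\<And>v. v \<in> carrier M \<Longrightarrow> z \<odot>\<^bsub>M\<^esub> v = \<zero>\<^bsub>M\<^esub> \<Longrightarrow> v = \<zero>\<^bsub>M\<^esub>"
      and ab: "a \<in> carrier P" "x \<otimes>\<^bsub>L\<^esub> z = z \<otimes>\<^bsub>L\<^esub> a" "b \<in> carrier P" "y \<otimes>\<^bsub>L\<^esub> z = z \<otimes>\<^bsub>L\<^esub> b" for z a b
  proof -
    have "(\<lambda>v. z \<odot>\<^bsub>M\<^esub> v) ` carrier M \<noteq> {\<zero>\<^bsub>M\<^esub>}"
    proof
      assume zero: "(\<lambda>v. z \<odot>\<^bsub>M\<^esub> v) ` carrier M = {\<zero>\<^bsub>M\<^esub>}"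
      obtain v where "v \<in> carrier M" "v \<noteq> \<zero>\<^bsub>M\<^esub>" using nz M.zero_closed by blast
      then show False using z(2)[of v] zero by blast
    qed
    then have "(\<lambda>v. z \<odot>\<^bsub>M\<^esub> v) ` carrier M = carrier M"
      using act_image_submodule[OF z(1) ab] simple by (auto simp: simple_module_def)
    then show ?thesis using act_inj_on[OF z] by (simp add: bij_betw_def)
  qed
  have yx: "x \<otimes>\<^bsub>L\<^esub> y = y \<otimes>\<^bsub>L\<^esub> (q \<odot>\<^bsub>L\<^esub> x)" "y \<otimes>\<^bsub>L\<^esub> x = x \<otimes>\<^bsub>L\<^esub> (inverse q \<odot>\<^bsub>L\<^esub> y)"
    by (simp_all add: torus_normalise flip: smult_assoc)
  show "bij_betw (\<lambda>v. x \<odot>\<^bsub>M\<^esub> v) (carrier M) (carrier M)"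
  proof (rule bij[of x x "inverse q \<odot>\<^bsub>L\<^esub> y"])
    fix v assume v: "v \<in> carrier M" "x \<odot>\<^bsub>M\<^esub> v = \<zero>\<^bsub>M\<^esub>"
    \<comment> \<open>With \<open>x\<close> written as the right factor, the kernel of
      \<open>x\<close> is seen to lie in that of \<open>xy\<close>.\<close>
    have "x \<otimes>\<^bsub>L\<^esub> y = (q \<odot>\<^bsub>L\<^esub> y) \<otimes>\<^bsub>L\<^esub> x"
      by (simp add: torus_normalise flip: smult_assoc)
    then have "(x \<otimes>\<^bsub>L\<^esub> y) \<odot>\<^bsub>M\<^esub> v = \<zero>\<^bsub>M\<^esub>"
      using v P.smult_closed[of y q] by (simp add: plane_act_mult)
    then show "v = \<zero>\<^bsub>M\<^esub>" using inj v by blast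
  qed (use yx P.smult_closed in auto)
  show "bij_betw (\<lambda>v. y \<odot>\<^bsub>M\<^esub> v) (carrier M) (carrier M)"
  proof (rule bij[of y "q \<odot>\<^bsub>L\<^esub> x" y])
    fix v assume v: "v \<in> carrier M" "y \<odot>\<^bsub>M\<^esub> v = \<zero>\<^bsub>M\<^esub>"
    then have "(x \<otimes>\<^bsub>L\<^esub> y) \<odot>\<^bsub>M\<^esub> v = \<zero>\<^bsub>M\<^esub>" by (simp add: plane_act_mult)
    then show "v = \<zero>\<^bsub>M\<^esub>" using inj v by blast
  qed (use yx P.smult_closed in auto)
qed

text \<open>The inverse maps supply operators for the two missing generators. The new action agrees
  with the old one on \<open>x\<close> and \<open>y\<close>, hence on everything that they
  generate.\<close>

lemma extends_to_torus:
  assumes bij: "bij_betw (\<lambda>v. x \<odot>\<^bsub>M\<^esub> v) (carrier M) (carrier M)"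
    "bij_betw (\<lambda>v. y \<odot>\<^bsub>M\<^esub> v) (carrier M) (carrier M)"
  obtains s where "left_module L (M\<lparr>smult := s\<rparr>)"
    "\<And>u v. u \<in> carrier P \<Longrightarrow> v \<in> carrier M \<Longrightarrow> s u v = u \<odot>\<^bsub>M\<^esub> v"
proof -
  define xinv where "xinv = inv_into (carrier M) (\<lambda>v. x \<odot>\<^bsub>M\<^esub> v)"
  define yinv where "yinv = inv_into (carrier M) (\<lambda>v. y \<odot>\<^bsub>M\<^esub> v)"
  have inv: "xinv v \<in> carrier M" "yinv v \<in> carrier M" "x \<odot>\<^bsub>M\<^esub> xinv v = v" "y \<odot>\<^bsub>M\<^esub> yinv v = v"
    "xinv (x \<odot>\<^bsub>M\<^esub> v) = v" "yinv (y \<odot>\<^bsub>M\<^esub> v) = v" if "v \<in> carrier M" for v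
    using bij that unfolding xinv_def yinv_def bij_betw_def
    by (auto intro: inv_into_into f_inv_into_f inv_into_f_f)
  \<comment> \<open>An identity for an inverse map is checked by applying \<open>x\<close> (below:
    \<open>y\<close>) to the claimed value. Additivity and linearity of the inverses follow in this
    way.\<close>
  have inv_eq: "xinv v = w" if "w \<in> carrier M" "x \<odot>\<^bsub>M\<^esub> w = v" for v w
    using inv(5) that by blast
  have inv_eq': "yinv v = w" if "w \<in> carrier M" "y \<odot>\<^bsub>M\<^esub> w = v" for v w
    using inv(6) that by blast
  have scalar: "c \<odot>\<^bsub>L\<^esub> \<one>\<^bsub>L\<^esub> \<in> carrier P" for c
    using P.one_closed P.smult_closed by blast
  let ?act = "\<lambda>g v. case g of GX \<Rightarrow> x \<odot>\<^bsub>M\<^esub> v | GXi \<Rightarrow> xinv v | GY \<Rightarrow> y \<odot>\<^bsub>M\<^esub> v | GYi \<Rightarrow> yinv v"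
  have comm: "z \<odot>\<^bsub>M\<^esub> scale c v = scale c (z \<odot>\<^bsub>M\<^esub> v)" if "z \<in> carrier P" "v \<in> carrier M" for z c v
    using plane_act_smult[OF that] by simp
  interpret T: torus_operators M q scale ?act
  proof (unfold_locales, goal_cases)
    case (1 v c)
    then show ?case using scalar by simp
  next
    case (2 v c d)
    then show ?case
      using P.smult_l_distr[OF P.one_closed, of c d] scalar plane_act_l_distr[of "c \<odot>\<^bsub>L\<^esub> \<one>\<^bsub>L\<^esub>" "d \<odot>\<^bsub>L\<^esub> \<one>\<^bsub>L\<^esub>" v] by simp
  next
    case (3 v w c)
    then show ?case using scalar by (simp add: act_r_distr)
  next
    case (4 v c d)
    then show ?case
      using plane_act_smult(1)[OF scalar[of d], of v c] P.smult_assoc[OF P.one_closed, of c d] by simp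
  next
    case (5 v)
    then show ?case by simp
  next
    case (6 v g)
    then show ?case using inv by (cases g) simp_all
  next
    case (7 v w g)
    then show ?case
      by (cases g) (auto simp: act_r_distr inv intro!: inv_eq inv_eq')
  next
    case (8 v g c)
    then show ?case
      using scalar by (cases g) (auto simp: comm inv intro!: inv_eq inv_eq')
  next
    case (13 v)
    have "(x \<otimes>\<^bsub>L\<^esub> y) \<odot>\<^bsub>M\<^esub> v = (q \<odot>\<^bsub>L\<^esub> (y \<otimes>\<^bsub>L\<^esub> x)) \<odot>\<^bsub>M\<^esub> v"
      by (simp only: quantum_torus_relations(5))
    then show ?case
      using 13 P.m_closed[of y x] by (simp add: plane_act_smult(1)[of "y \<otimes>\<^bsub>L\<^esub> x"] plane_act_mult)
  qed (simp_all add: inv)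
  define s where "s = T.torus_act"
  have mod: "left_module L (M\<lparr>smult := s\<rparr>)"
    unfolding s_def by (rule T.torus_act_left_module) simp_all
  interpret E: left_module L "M\<lparr>smult := s\<rparr>" by (rule mod)
  have "s u v = u \<odot>\<^bsub>M\<^esub> v" if "u \<in> carrier P" "v \<in> carrier M" for u v
    using that
  proof (induction arbitrary: v rule: plane_induct)
    case x
    then show ?case by (simp add: s_def T.torus_act_class T.free_act_gen)
  next
    case y
    then show ?case by (simp add: s_def T.torus_act_class T.free_act_gen)
  next
    case one
    then show ?case using E.act_one[of v] by simp
  next
    case (scale c u)
    \<comment> \<open>The two actions must agree on scalars too, because scaling \<open>u\<close> by
      \<open>c\<close> is treated as multiplication by the scalar element.\<close>
    have "s (c \<odot>\<^bsub>L\<^esub> \<one>\<^bsub>L\<^esub>) v = scale c v" if "v \<in> carrier M" for v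
    proof -
      have "s (torus_class q (Poly_Mapping.single [] c)) v = scale c v"
        using that unfolding s_def by (subst T.torus_act_class) simp_all
      moreover have "torus_class q (Poly_Mapping.single [] c) = c \<odot>\<^bsub>L\<^esub> \<one>\<^bsub>L\<^esub>"
        by (simp add: torus_simps)
      ultimately show ?thesis by (simp only:)
    qed
    then show ?case
      using scale E.act_assoc[of "c \<odot>\<^bsub>L\<^esub> \<one>\<^bsub>L\<^esub>" u v] plane_subset[of u]
      by (simp add: smult_mult_left plane_act_smult(1)[of u])
  next
    case (add u u')
    then show ?case using E.act_l_distr[of u u' v] plane_subset by (simp add: plane_act_l_distr)
  next
    case (mult u u')
    then show ?case using E.act_assoc[of u u' v] plane_subset by (simp add: plane_act_mult)
  qed
  with mod show ?thesis using that by blast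
qed

end

context plane_module
begin

text \<open>A subgroup stable under the torus is stable under the plane, so the larger algebra has
  no additional submodules.\<close>

lemma simple_extension:
  assumes "simple_module P M" "left_module L (M\<lparr>smult := s\<rparr>)"
    and "\<And>u v. u \<in> carrier P \<Longrightarrow> v \<in> carrier M \<Longrightarrow> s u v = u \<odot>\<^bsub>M\<^esub> v"
  shows "simple_module L (M\<lparr>smult := s\<rparr>)"
proof -
  have "submodule N P M" if "submodule N L (M\<lparr>smult := s\<rparr>)" for N
  proof (intro submodule.intro submodule_axioms.intro)
    show sub: "subgroup N (add_monoid M)"
      using submodule.axioms(1)[OF that] by simp
    fix u v assume "u \<in> carrier P" "v \<in> N"
    then show "u \<odot>\<^bsub>M\<^esub> v \<in> N"
      using submodule.smult_closed[OF that, of u v] assms(3)[of u v] plane_subset[of u]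
        subgroup.mem_carrier[OF sub] by simp
  qed
  then show ?thesis using assms(1,2) by (auto simp: simple_module_def)
qed

end

section \<open>Annihilating polynomials from finite spans\<close>

context torus_module
begin

text \<open>More powers than spanning vectors force a linear relation. \<open>B\<close> need not be
  independent: the relation is found among the rows of coefficients and carries over to the
  vectors.\<close>

lemma annihilating_poly_exists:
  assumes B: "finite B" "B \<subseteq> carrier M" and w: "w \<in> carrier M"
    and span: "\<And>i. \<exists>c. torus_class q (r ^ i) \<odot>\<^bsub>M\<^esub> w = (\<Oplus>\<^bsub>M\<^esub>b\<in>B. scale (c b) b)"
  shows "\<exists>p. p \<noteq> 0 \<and> torus_class q (free_peval r p) \<odot>\<^bsub>M\<^esub> w = \<zero>\<^bsub>M\<^esub>"
proof -
  have "\<exists>c. \<forall>i. torus_class q (r ^ i) \<odot>\<^bsub>M\<^esub> w = (\<Oplus>\<^bsub>M\<^esub>b\<in>B. scale (c i b) b)"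
    by (intro choice allI span)
  then obtain c where c: "\<And>i. torus_class q (r ^ i) \<odot>\<^bsub>M\<^esub> w = (\<Oplus>\<^bsub>M\<^esub>b\<in>B. scale (c i b) b)"
    by blast
  \<comment> \<open>Exponents 0 to \<open>card B\<close> give one unknown more than there are
    equations.\<close>
  obtain a where a: "\<exists>i\<in>{..card B}. a i \<noteq> 0" "\<forall>b\<in>B. (\<Sum>i\<le>card B. a i * c i b) = 0"
    using homogeneous_system_nontrivial[of B "{..card B}" c] B by auto
  have Bcl: "b \<in> carrier M" if "b \<in> B" for b using B that by blast
  have sum: "torus_class q (\<Sum>i<n. Poly_Mapping.single [] (a i) * r ^ i) \<odot>\<^bsub>M\<^esub> w =
      (\<Oplus>\<^bsub>M\<^esub>b\<in>B. scale (\<Sum>i<n. a i * c i b) b)" for n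
  proof (induction n)
    case 0
    have "torus_class q (0 :: torus_gen free_elem) \<odot>\<^bsub>M\<^esub> w = \<zero>\<^bsub>M\<^esub>"
      using torus_class_scalar[of 0] w by simp
    moreover have "(\<Oplus>\<^bsub>M\<^esub>b\<in>B. scale 0 b) = \<zero>\<^bsub>M\<^esub>"
      using Bcl by (intro M.add.finprod_one_eqI) simp
    ultimately show ?case by simp
  next
    case (Suc n)
    have scale_sum: "scale d (\<Oplus>\<^bsub>M\<^esub>b\<in>B. scale (e b) b) = (\<Oplus>\<^bsub>M\<^esub>b\<in>B. scale (d * e b) b)" for d e
      using B
    proof (induction B rule: finite_induct)
      case empty
      show ?case by simp
    next
      case (insert b B)
      then have cl: "b \<in> carrier M" "\<And>b'. b' \<in> B \<Longrightarrow> b' \<in> carrier M" by auto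
      with insert show ?case by (simp add: M.finsum_insert M.finsum_closed Pi_def act_r_distr)
    qed
    have "torus_class q (\<Sum>i<Suc n. Poly_Mapping.single [] (a i) * r ^ i) \<odot>\<^bsub>M\<^esub> w =
        (\<Oplus>\<^bsub>M\<^esub>b\<in>B. scale (\<Sum>i<n. a i * c i b) b) \<oplus>\<^bsub>M\<^esub> (a n \<odot>\<^bsub>L\<^esub> torus_class q (r ^ n)) \<odot>\<^bsub>M\<^esub> w"
      using w Suc by (simp add: act_l_distr torus_simps(3) flip: torus_simps(2))
    also have "(a n \<odot>\<^bsub>L\<^esub> torus_class q (r ^ n)) \<odot>\<^bsub>M\<^esub> w = (\<Oplus>\<^bsub>M\<^esub>b\<in>B. scale (a n * c n b) b)"
      using smult_act[of "torus_class q (r ^ n)" w "a n"] w scale_sum[of "a n" "c n"] c[of n] by simp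
    also have "(\<Oplus>\<^bsub>M\<^esub>b\<in>B. scale (\<Sum>i<n. a i * c i b) b) \<oplus>\<^bsub>M\<^esub> \<dots> =
        (\<Oplus>\<^bsub>M\<^esub>b\<in>B. scale (\<Sum>i<n. a i * c i b) b \<oplus>\<^bsub>M\<^esub> scale (a n * c n b) b)"
      using Bcl by (intro M.finsum_addf[symmetric]) auto
    also have "\<dots> = (\<Oplus>\<^bsub>M\<^esub>b\<in>B. scale (\<Sum>i<Suc n. a i * c i b) b)"
      using Bcl by (intro M.finsum_cong') (auto simp: smult_l_distr act_l_distr)
    finally show ?case .
  qed
  define p where "p = (\<Sum>i\<le>card B. Polynomial.monom (a i) i)"
  have p: "Polynomial.coeff p i = (if i \<le> card B then a i else 0)" for i
    by (simp add: p_def coeff_sum)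
  have "degree p \<le> card B" by (rule degree_le) (simp add: p)
  then have "free_peval r p = (\<Sum>i<Suc (card B). Poly_Mapping.single [] (a i) * r ^ i)"
    by (simp add: free_peval_superset[of p "card B"] p lessThan_Suc_atMost del: sum.lessThan_Suc)
  then have "torus_class q (free_peval r p) \<odot>\<^bsub>M\<^esub> w =
      (\<Oplus>\<^bsub>M\<^esub>b\<in>B. scale (\<Sum>i\<le>card B. a i * c i b) b)"
    using sum[of "Suc (card B)"] by (simp only: lessThan_Suc_atMost)
  also have "\<dots> = \<zero>\<^bsub>M\<^esub>"
    using a(2) Bcl by (intro M.add.finprod_one_eqI) simp
  finally have "torus_class q (free_peval r p) \<odot>\<^bsub>M\<^esub> w = \<zero>\<^bsub>M\<^esub>" .
  moreover have "p \<noteq> 0"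
    using a(1) p by (metis atMost_iff coeff_0)
  ultimately show ?thesis by blast
qed

end

lemma generated_subalgebra_power:
  assumes "complex_algebra A" "d \<in> carrier A"
  shows "d [^]\<^bsub>A\<^esub> (i :: nat) \<in> generated_subalgebra A {d}"
proof -
  interpret complex_algebra A by fact
  have "d [^]\<^bsub>A\<^esub> i \<in> B" if "subring B A" "d \<in> B" for B
    by (induction i) (use that subringE(3,6)[OF that(1)] in auto)
  then show ?thesis by (auto simp: generated_subalgebra_def)
qed

section \<open>Simple modules over the plane\<close>

context plane_module
begin

lemma simple_locally_finite_isomorphic:
  assumes simple: "simple_module P M" and generic: "generic q" and mn: "(m, n) \<noteq> (0, 0)"
    and finite: "locally_finite P (plane_monomial q m n) M"
    and inj: "\<And>v. v \<in> carrier M \<Longrightarrow> (x \<otimes>\<^bsub>L\<^esub> y) \<odot>\<^bsub>M\<^esub> v = \<zero>\<^bsub>M\<^esub> \<Longrightarrow> v = \<zero>\<^bsub>M\<^esub>"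
  shows "\<exists>\<tau> \<in> algebra_automorphisms L. module_isomorphic P (twist \<tau> (basic_module q)) M"
proof -
  obtain s where s: "left_module L (M\<lparr>smult := s\<rparr>)"
      "\<And>u v. u \<in> carrier P \<Longrightarrow> v \<in> carrier M \<Longrightarrow> s u v = u \<odot>\<^bsub>M\<^esub> v"
    using extends_to_torus[OF act_bij_betw[OF simple inj]] by blast
  let ?M = "M\<lparr>smult := s\<rparr>"
  have simple': "simple_module L ?M" by (rule simple_extension[OF simple s])
  interpret E: torus_module q ?M
    by (intro torus_module.intro torus_algebra_axioms s(1))
  let ?r = "free_gen GX ^ m * free_gen GY ^ n"
  have D: "torus_class q ?r = x [^]\<^bsub>L\<^esub> m \<otimes>\<^bsub>L\<^esub> y [^]\<^bsub>L\<^esub> n"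
    by (simp flip: torus_simps(1) torus_class_power)
  have monomial: "plane_monomial q m n = torus_class q ?r"
    by (simp add: plane_monomial_def D)
  have D_P: "torus_class q ?r \<in> carrier P"
    using P.m_closed[OF P.nat_pow_closed[of x m] P.nat_pow_closed[of y n]] by (simp add: D)
  obtain w where w: "w \<in> carrier M" "w \<noteq> \<zero>\<^bsub>M\<^esub>"
    using simple M.zero_closed by (auto simp: simple_module_def)
  obtain B where B: "finite B" "B \<subseteq> carrier M"
      "{u \<odot>\<^bsub>M\<^esub> w |u. u \<in> generated_subalgebra P {torus_class q ?r}} = complex_span P M B"
    using finite w(1) unfolding locally_finite_def monomial by blast
  have scalar: "c \<odot>\<^bsub>L\<^esub> \<one>\<^bsub>L\<^esub> \<in> carrier P" for c
    using P.one_closed P.smult_closed by blast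
  have "\<exists>c. torus_class q (?r ^ i) \<odot>\<^bsub>?M\<^esub> w = (\<Oplus>\<^bsub>?M\<^esub>b\<in>B. E.scale (c b) b)" for i
  proof -
    have "torus_class q ?r [^]\<^bsub>P\<^esub> i \<in> generated_subalgebra P {torus_class q ?r}"
      by (rule generated_subalgebra_power[OF complex_algebra_quantum_plane D_P])
    then have "torus_class q (?r ^ i) \<odot>\<^bsub>M\<^esub> w \<in> complex_span P M B"
      unfolding B(3)[symmetric] by (auto simp: torus_class_power)
    then obtain c where c: "torus_class q (?r ^ i) \<odot>\<^bsub>M\<^esub> w = (\<Oplus>\<^bsub>M\<^esub>b\<in>B. scale (c b) b)"
      by (auto simp: complex_span_def)
    have "torus_class q (?r ^ i) \<in> carrier P"
      using P.nat_pow_closed[OF D_P, of i] by (simp add: torus_class_power)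
    then have "torus_class q (?r ^ i) \<odot>\<^bsub>?M\<^esub> w = torus_class q (?r ^ i) \<odot>\<^bsub>M\<^esub> w"
      using s(2) w(1) by simp
    moreover have "(\<Oplus>\<^bsub>?M\<^esub>b\<in>B. E.scale (c b) b) = (\<Oplus>\<^bsub>M\<^esub>b\<in>B. scale (c b) b)"
    proof -
      have "(\<Oplus>\<^bsub>?M\<^esub>b\<in>B. f b) = (\<Oplus>\<^bsub>M\<^esub>b\<in>B. f b)" for f
        by (simp add: finsum_def)
      moreover have "(\<Oplus>\<^bsub>M\<^esub>b\<in>B. E.scale (c b) b) = (\<Oplus>\<^bsub>M\<^esub>b\<in>B. scale (c b) b)"
        using B(2) scalar s(2) by (intro M.finsum_cong') auto
      ultimately show ?thesis by simp
    qed
    ultimately show ?thesis using c by (intro exI[of _ c]) simp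
  qed
  then obtain p where "p \<noteq> 0" "torus_class q (free_peval ?r p) \<odot>\<^bsub>?M\<^esub> w = \<zero>\<^bsub>?M\<^esub>"
    using E.annihilating_poly_exists[of B w ?r] B w by auto
  then obtain v z where "v \<in> carrier ?M" "v \<noteq> \<zero>\<^bsub>?M\<^esub>" "torus_class q ?r \<odot>\<^bsub>?M\<^esub> v = E.scale z v"
    using E.eigenvector_of_annihilating_poly[of p w ?r] w by auto
  then obtain \<tau> where \<tau>: "\<tau> \<in> algebra_automorphisms L" "module_isomorphic L (twist \<tau> (basic_module q)) ?M"
    using isomorphic_of_monomial_eigenvector[OF generic mn simple', of v z] unfolding D by blast
  then obtain h where h: "bij_betw h UNIV (carrier M)"
      "\<And>f g. h (f + g) = h f \<oplus>\<^bsub>M\<^esub> h g"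
      "\<And>a f. a \<in> carrier L \<Longrightarrow> h (\<tau> a \<odot>\<^bsub>basic_module q\<^esub> f) = s a (h f)"
    by (auto simp: module_isomorphic_def)
  have "h f \<in> carrier M" for f using h(1) by (auto simp: bij_betw_def)
  \<comment> \<open>On the plane the extended action is the original one, so the isomorphism over
    the torus restricts.\<close>
  then have "module_isomorphic P (twist \<tau> (basic_module q)) M"
    unfolding module_isomorphic_def using h plane_subset s(2) by (intro exI[of _ h]) simp
  then show ?thesis using \<tau>(1) by blast
qed

end

theorem corollary6p1:
  fixes q :: complex and M :: "(torus_elem, 'v) module"
  assumes "q \<noteq> 0" and "generic q"
    and "simple_admissible q M"
  shows "\<exists>\<tau> \<in> algebra_automorphisms (quantum_torus q).
           module_isomorphic (quantum_plane q) (twist \<tau> (basic_module q)) M"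
proof -
  have simple: "simple_module (quantum_plane q) M" and adm: "admissible q M"
    using assms(3) by (simp_all add: simple_admissible_def)
  interpret plane_module q M
    using assms(1) simple
    by (intro plane_module.intro torus_algebra.intro) (simp_all add: simple_module_def)
  obtain k :: nat and N and m n :: "nat \<Rightarrow> nat" where N:
      "\<And>j. j < k \<Longrightarrow> submodule (N j) P M \<and> (m j, n j) \<noteq> (0, 0) \<and>
         locally_D_finite q (m j) (n j) (M\<lparr>carrier := N j\<rparr>)"
    and sum: "carrier M = {\<Oplus>\<^bsub>M\<^esub>j\<in>{..<k}. v j |v. \<forall>j < k. v j \<in> N j}"
    and kappa: "inj_on (kappa q M) (carrier M)"
    using adm unfolding admissible_def by blast
  \<comment> \<open>By simplicity every other \<open>N j\<close> is zero, and a sum of zero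
    submodules cannot be \<open>M\<close>.\<close>
  have "\<exists>j<k. N j = carrier M"
  proof (rule ccontr)
    assume "\<not> (\<exists>j<k. N j = carrier M)"
    then have "N j = {\<zero>\<^bsub>M\<^esub>}" if "j < k" for j
      using N[OF that] simple that by (auto simp: simple_module_def)
    then have "(\<Oplus>\<^bsub>M\<^esub>j\<in>{..<k}. v j) = \<zero>\<^bsub>M\<^esub>" if "\<forall>j<k. v j \<in> N j" for v
      using that by (intro M.add.finprod_one_eqI) auto
    then have "carrier M \<subseteq> {\<zero>\<^bsub>M\<^esub>}" by (subst sum) blast
    then show False using simple M.zero_closed by (auto simp: simple_module_def)
  qed
  then obtain j where j: "j < k" "N j = carrier M" by blast
  have xy: "x \<otimes>\<^bsub>L\<^esub> y \<in> xy_powers q"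
    unfolding xy_powers_def using P.nat_pow_eone[OF P.m_closed[of x y]] by (auto intro!: exI[of _ 1])
  have sub: "xy_powers q \<subseteq> carrier P"
    unfolding xy_powers_def using P.nat_pow_closed[OF P.m_closed[of x y]] by auto
  \<comment> \<open>\<open>xy\<close> is one of the inverted elements, so a vector that it kills has
    the same image under \<open>kappa\<close> as zero.\<close>
  have inj: "v = \<zero>\<^bsub>M\<^esub>" if "v \<in> carrier M" "(x \<otimes>\<^bsub>L\<^esub> y) \<odot>\<^bsub>M\<^esub> v = \<zero>\<^bsub>M\<^esub>" for v
  proof (rule inj_onD[OF kappa _ that(1) M.zero_closed])
    show "kappa q M v = kappa q M \<zero>\<^bsub>M\<^esub>"
      unfolding kappa_def using sub xy that
      by (rule localisation_unit_eq_of_annihilated[OF complex_algebra_quantum_plane left_module_axioms])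
  qed
  have "M\<lparr>carrier := N j\<rparr> = M" by (simp add: j(2))
  then have "locally_finite P (plane_monomial q (m j) (n j)) M"
    using N[OF j(1)] by (simp only: locally_D_finite_def)
  moreover have "(m j, n j) \<noteq> (0, 0)" using N[OF j(1)] by blast
  ultimately show ?thesis
    using simple_locally_finite_isomorphic[OF simple assms(2)] inj by blast
qed

end
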